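(* Let $\gamma\in[0,1]$, $\alpha>0$, $A\in\mathbb{R}^{M\times N}$, $Y\in\mathbb{R}^{M\times K}$, $\kappa,\beta\in(0,1)$ and $\sigma_{\max}>0$. Let $Z_0\in\mathbb{R}^{N\times K}$ be given, with either $\gamma>0$ or $Z_0^TZ_0$ invertible, and let $(Z_k)_{k\ge0}$, $(\sigma_k)_{k\ge0}$ be generated by $Z_{k+1}=Z^+_{\sigma_k}$, with $\sigma_k$ chosen by the line search described in the context. Assume that there is a constant $C_0$ with $\|Z_k\|_{\mathrm{op}}\le C_0$ for all $k\ge1$. Then: (1) In every iteration, $J(Z_{k+1})-J(Z_k)\le\kappa\,\operatorname{pred}_{\sigma_k}(Z_k)\le0$. (2) $\inf_k\sigma_k>0$. (3) Every accumulation point $Z'$ of the sequence $(Z_k)$ (with either $\gamma>0$ or $(Z')^TZ'$ invertible) satisfies the first-order necessary condition for $J$, namely $0\in\partial_C J(Z')$; explicitly, with $W'=(\gamma I+(1-\gamma)(Z')^TZ')^{-1}$ and $z'_n$ the rows of $Z'$ (as $1\times K$ vectors), $$z'_n\Big(\frac{1}{\|z'_n\|_{W'}}W'-\sum_{i:\,z'_i\ne0}\frac{1-\gamma}{\|z'_i\|_{W'}}W'(z'_i)^Tz'_iW'\Big)+\frac1\alpha\big(A^T(AZ'-Y)\big)_n=0\quad\text{if }z'_n\neq0,$$ $$\big\|\big(A^T(AZ'-Y)\big)_n\big\|_{(W')^{-1}}\le\alpha\quad\text{if }z'_n=0.$$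
   Context: For a symmetric positive definite $W\in\mathbb{R}^{K\times K}$ and a row vector $z\in\mathbb{R}^{1\times K}$: $\|z\|_W=\sqrt{zWz^T}$; for $Z\in\mathbb{R}^{N\times K}$ with rows $z_n$: $\|Z\|_{W,1}=\sum_n\|z_n\|_W$, $\|Z\|_{W,2}=(\sum_n\|z_n\|_W^2)^{1/2}$, and $\langle Z,Z'\rangle_W=\operatorname{tr}(ZW(Z')^T)$. $(\cdot)_n$ denotes the $n$-th row, $\|\cdot\|_{\mathrm{op}}$ the operator norm induced by the Euclidean norm, $\|\cdot\|_{\mathrm{Fro}}$ the Frobenius norm, $\partial_C$ the Clarke subdifferential. Objective: $J(Z)=\Psi_\gamma(Z)+\frac1{2\alpha}\|AZ-Y\|_{\mathrm{Fro}}^2$, where $\Psi_\gamma(Z)=\|Z(\gamma I+(1-\gamma)Z^TZ)^{\dagger/2}\|_{2,1}$; here $\|\cdot\|_{2,1}$ is the sum of Euclidean row norms and $(\cdot)^{\dagger/2}$ is the square root of the Moore–Penrose pseudo-inverse. Iteration: given $Z_k$ with rows $z^k_n$ and $\gamma I+(1-\gamma)Z_k^TZ_k$ invertible, set $W_k=(\gamma I+(1-\gamma)Z_k^TZ_k)^{-1}$, $\Lambda_k=-\sum_{n:\,z^k_n\ne0}\frac{1-\gamma}{\|z^k_n\|_{W_k}}W_k(z^k_n)^Tz^k_nW_k$, and $G_k=(Z_k\Lambda_k+\frac1\alpha A^T(AZ_k-Y))W_k^{-1}$. For $\sigma>0$, the candidate is $Z^+_\sigma=\operatorname{Prox}_{W_k,\sigma}(Z_k-\sigma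 G_k)$, where $\operatorname{Prox}_{W,\sigma}(Z')=\arg\min_Z\|Z\|_{W,1}+\frac1{2\sigma}\|Z-Z'\|_{W,2}^2$. The predicted decrease is $\operatorname{pred}_\sigma(Z_k)=\|Z^+_\sigma\|_{W_k,1}-\|Z_k\|_{W_k,1}+\langle G_k,Z^+_\sigma-Z_k\rangle_{W_k}$. Line search: with $\sigma_{-1}=\sigma_{\max}$, $\sigma_k$ is the largest $\sigma\in\{\beta^j\min\{\sigma_{\max},\sigma_{k-1}/\beta\}: j=0,1,2,\dots\}$ such that $\gamma I+(1-\gamma)(Z^+_\sigma)^TZ^+_\sigma$ is invertible and $J(Z^+_\sigma)-J(Z_k)\le\kappa\operatorname{pred}_\sigma(Z_k)$. *)

theory Defs
  imports "HOL-Analysis.Analysis"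
begin

text \<open>
  A matrix in \<open>R^(N x K)\<close> has type \<^typ>\<open>real^'k^'n\<close>, and its \<open>n\<close>-th row is \<open>Z $ n\<close>.  On this
  type the library's \<^const>\<open>norm\<close> is the Frobenius norm and its inner product is the
  Frobenius inner product.
\<close>

subsection \<open>Weighted norms\<close>

definition wnorm :: "real^'k^'k \<Rightarrow> real^'k \<Rightarrow> real" where
  "wnorm W z = sqrt ((z v* W) \<bullet> z)"

definition wnorm1 :: "real^'k^'k \<Rightarrow> real^'k^'n \<Rightarrow> real" where
  "wnorm1 W Z = (\<Sum>n\<in>UNIV. wnorm W (Z $ n))"

definition wnorm2 :: "real^'k^'k \<Rightarrow> real^'k^'n \<Rightarrow> real" where
  "wnorm2 W Z = sqrt (\<Sum>n\<in>UNIV. (wnorm W (Z $ n))\<^sup>2)"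

definition wprod :: "real^'k^'k \<Rightarrow> real^'k^'n \<Rightarrow> real^'k^'n \<Rightarrow> real" where
  "wprod W Z Z' = trace (Z ** W ** transpose Z')"

subsection \<open>Pseudo-inverse and matrix square root\<close>

definition is_pinv :: "real^'k^'k \<Rightarrow> real^'k^'k \<Rightarrow> bool" where
  "is_pinv M X \<longleftrightarrow> M ** X ** M = M \<and> X ** M ** X = X \<and>
     transpose (M ** X) = M ** X \<and> transpose (X ** M) = X ** M"

definition pinv :: "real^'k^'k \<Rightarrow> real^'k^'k" where
  "pinv M = (THE X. is_pinv M X)"

definition psd :: "real^'k^'k \<Rightarrow> bool" where
  "psd S \<longleftrightarrow> transpose S = S \<and> (\<forall>x. 0 \<le> x \<bullet> (S *v x))"

definition psd_sqrt :: "real^'k^'k \<Rightarrow> real^'k^'k" where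
  "psd_sqrt M = (THE S. psd S \<and> S ** S = M)"

subsection \<open>The objective\<close>

definition gram :: "real \<Rightarrow> real^'k^'n \<Rightarrow> real^'k^'k" where
  "gram \<gamma> Z = \<gamma> *\<^sub>R mat 1 + (1 - \<gamma>) *\<^sub>R (transpose Z ** Z)"

definition norm21 :: "real^'k^'n \<Rightarrow> real" where
  "norm21 Z = (\<Sum>n\<in>UNIV. norm (Z $ n))"

definition Psi :: "real \<Rightarrow> real^'k^'n \<Rightarrow> real" where
  "Psi \<gamma> Z = norm21 (Z ** psd_sqrt (pinv (gram \<gamma> Z)))"

definition objective ::
  "real \<Rightarrow> real \<Rightarrow> real^'n^'m \<Rightarrow> real^'k^'m \<Rightarrow> real^'k^'n \<Rightarrow> real" where
  "objective \<gamma> \<alpha> A Y Z = Psi \<gamma> Z + 1 / (2 * \<alpha>) * (norm (A ** Z - Y))\<^sup>2"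

subsection \<open>The iteration\<close>

definition weight :: "real \<Rightarrow> real^'k^'n \<Rightarrow> real^'k^'k" where
  "weight \<gamma> Z = matrix_inv (gram \<gamma> Z)"

text \<open>\<open>W z\<^sup>T z W\<close> for a row vector \<open>z\<close>; the index type \<^typ>\<open>1\<close> makes \<open>z\<close> a \<open>1 x K\<close> matrix.\<close>

definition rank1 :: "real^'k^'k \<Rightarrow> real^'k \<Rightarrow> real^'k^'k" where
  "rank1 W z = W ** (columnvector z :: real^1^'k) ** (rowvector z :: real^'k^1) ** W"

definition Lam :: "real \<Rightarrow> real^'k^'n \<Rightarrow> real^'k^'k" where
  "Lam \<gamma> Z = (let W = weight \<gamma> Z in
     - (\<Sum>n\<in>{n. Z $ n \<noteq> 0}. ((1 - \<gamma>) / wnorm W (Z $ n)) *\<^sub>R rank1 W (Z $ n)))"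

definition grad ::
  "real \<Rightarrow> real \<Rightarrow> real^'n^'m \<Rightarrow> real^'k^'m \<Rightarrow> real^'k^'n \<Rightarrow> real^'k^'n" where
  "grad \<gamma> \<alpha> A Y Z =
     (Z ** Lam \<gamma> Z + (1 / \<alpha>) *\<^sub>R (transpose A ** (A ** Z - Y))) ** matrix_inv (weight \<gamma> Z)"

definition prox :: "real^'k^'k \<Rightarrow> real \<Rightarrow> real^'k^'n \<Rightarrow> real^'k^'n" where
  "prox W \<sigma> Z' = (ARG_MIN (\<lambda>Z. wnorm1 W Z + 1 / (2 * \<sigma>) * (wnorm2 W (Z - Z'))\<^sup>2) Z. True)"

definition candidate ::
  "real \<Rightarrow> real \<Rightarrow> real^'n^'m \<Rightarrow> real^'k^'m \<Rightarrow> real \<Rightarrow> real^'k^'n \<Rightarrow> real^'k^'n" where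
  "candidate \<gamma> \<alpha> A Y \<sigma> Z = prox (weight \<gamma> Z) \<sigma> (Z - \<sigma> *\<^sub>R grad \<gamma> \<alpha> A Y Z)"

definition predicted ::
  "real \<Rightarrow> real \<Rightarrow> real^'n^'m \<Rightarrow> real^'k^'m \<Rightarrow> real \<Rightarrow> real^'k^'n \<Rightarrow> real" where
  "predicted \<gamma> \<alpha> A Y \<sigma> Z =
     (let W = weight \<gamma> Z; Z' = candidate \<gamma> \<alpha> A Y \<sigma> Z in
      wnorm1 W Z' - wnorm1 W Z + wprod W (grad \<gamma> \<alpha> A Y Z) (Z' - Z))"

subsection \<open>The line search\<close>

definition acceptable ::
  "real \<Rightarrow> real \<Rightarrow> real^'n^'m \<Rightarrow> real^'k^'m \<Rightarrow> real \<Rightarrow> real^'k^'n \<Rightarrow> real \<Rightarrow> bool" where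
  "acceptable \<gamma> \<alpha> A Y \<kappa> Z \<sigma> \<longleftrightarrow>
     invertible (gram \<gamma> (candidate \<gamma> \<alpha> A Y \<sigma> Z)) \<and>
     objective \<gamma> \<alpha> A Y (candidate \<gamma> \<alpha> A Y \<sigma> Z) - objective \<gamma> \<alpha> A Y Z
       \<le> \<kappa> * predicted \<gamma> \<alpha> A Y \<sigma> Z"

definition trial_steps :: "real \<Rightarrow> real \<Rightarrow> real \<Rightarrow> real set" where
  "trial_steps \<beta> \<sigma>max \<sigma>prev = range (\<lambda>j::nat. \<beta> ^ j * min \<sigma>max (\<sigma>prev / \<beta>))"

text \<open>\<open>\<sigma>\<close> is the step size selected at \<open>Z\<close> when the preceding one was \<open>\<sigma>prev\<close>.\<close>

definition line_search ::
  "real \<Rightarrow> real \<Rightarrow> real^'n^'m \<Rightarrow> real^'k^'m \<Rightarrow> real \<Rightarrow> real \<Rightarrow> real \<Rightarrow> real \<Rightarrow> real^'k^'n \<Rightarrow> real \<Rightarrow> bool"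
where
  "line_search \<gamma> \<alpha> A Y \<kappa> \<beta> \<sigma>max \<sigma>prev Z \<sigma> \<longleftrightarrow>
     (let S = {s \<in> trial_steps \<beta> \<sigma>max \<sigma>prev. acceptable \<gamma> \<alpha> A Y \<kappa> Z s}
      in \<sigma> \<in> S \<and> (\<forall>s\<in>S. s \<le> \<sigma>))"

subsection \<open>The Clarke subdifferential\<close>

text \<open>
  Clarke's generalized directional derivative
  \<open>limsup (f (y + t v) - f y) / t\<close> as \<open>y \<rightarrow> x\<close>, \<open>t \<down> 0\<close>, and the subdifferential it supports.
  Both are meant for functions that are Lipschitz near \<open>x\<close>; the limit superior is
  taken in \<^typ>\<open>ereal\<close> so that it is meaningful without that assumption.
\<close>

definition clarke_dd :: "('a::real_inner \<Rightarrow> real) \<Rightarrow> 'a \<Rightarrow> 'a \<Rightarrow> ereal" where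
  "clarke_dd f x v =
     Limsup (nhds x \<times>\<^sub>F at_right (0::real)) (\<lambda>(y, t). ereal ((f (y + t *\<^sub>R v) - f y) / t))"

definition clarke_subdiff :: "('a::real_inner \<Rightarrow> real) \<Rightarrow> 'a \<Rightarrow> 'a set" where
  "clarke_subdiff f x = {\<xi>. \<forall>v. ereal (\<xi> \<bullet> v) \<le> clarke_dd f x v}"

end

theory Submission
  imports Defs
begin

text \<open>
  Everything is measured in the metric of the current weight \<open>W = (gram \<gamma> Z)\<inverse>\<close>.  If
  \<open>d = \<parallel>D\<parallel>\<^bsub>W,2\<^esub>\<close> is at most \<open>1/4\<close>, then \<open>gram \<gamma> (Z + D)\<close> stays invertible and
  \<open>\<Psi>(Z + D) = \<parallel>Z + D\<parallel>\<^bsub>W,1\<^esub> + \<langle>Z \<Lambda>, D\<rangle> + O(d\<^sup>2)\<close>, with a constant that depends only on a bound for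
  \<open>\<parallel>Z\<parallel>\<close>; this relative metric keeps the estimate uniform for \<open>\<gamma> = 0\<close>, where \<open>Z\<^sup>T Z\<close> may degenerate
  along the iteration.

  The variational inequality of the proximal step gives \<open>d\<^sup>2 \<le> - \<sigma> pred\<close> and \<open>d = O(\<sigma>)\<close>, so all
  sufficiently small steps are accepted, which bounds the step sizes from below.  As \<open>J \<ge> 0\<close>, the
  predicted decreases tend to \<open>0\<close>, hence so does \<open>d\<close>, and the variational inequality passes to the
  limit: \<open>\<parallel>X\<parallel>\<^bsub>W',1\<^esub> - \<parallel>Z'\<parallel>\<^bsub>W',1\<^esub> + \<langle>G', X - Z'\<rangle>\<^bsub>W'\<^esub> \<ge> 0\<close> for all \<open>X\<close>.  Varying one row of
  \<open>X\<close> yields the explicit conditions, and the expansion of \<open>J\<close> along rays from \<open>Z'\<close> yields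
  Clarke stationarity.
\<close>


subsection \<open>Square roots of positive definite matrices\<close>

definition posdef :: "real^'k^'k \<Rightarrow> bool" where
  "posdef W \<longleftrightarrow> transpose W = W \<and> (\<forall>x. x \<noteq> 0 \<longrightarrow> 0 < x \<bullet> (W *v x))"

lemma symmetric_matrix_move:
  fixes W :: "real^'k^'k"
  assumes "transpose W = W"
  shows "(W *v x) \<bullet> y = x \<bullet> (W *v y)"
  by (metis assms dot_lmul_matrix transpose_matrix_vector)

text \<open>The constant is the minimum of the quadratic form over the compact unit sphere;
  homogeneity of degree two carries it to all vectors.\<close>

lemma posdef_coercive:
  fixes W :: "real^'k^'k"
  assumes "posdef W"
  obtains l where "0 < l" "\<And>x. l * (norm x)\<^sup>2 \<le> x \<bullet> (W *v x)"
proof -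
  let ?S = "sphere (0::real^'k) 1"
  have "compact ?S" by simp
  moreover have "?S \<noteq> {}" by simp
  moreover have "continuous_on ?S (\<lambda>x. x \<bullet> (W *v x))"
    by (intro continuous_intros linear_continuous_on) auto
  ultimately obtain u where u: "u \<in> ?S" "\<And>x. x \<in> ?S \<Longrightarrow> u \<bullet> (W *v u) \<le> x \<bullet> (W *v x)"
    using continuous_attains_inf[of ?S "\<lambda>x. x \<bullet> (W *v x)"] by blast
  let ?l = "u \<bullet> (W *v u)"
  have "u \<noteq> 0" using u(1) by auto
  hence "0 < ?l" using assms by (auto simp: posdef_def)
  moreover have "?l * (norm x)\<^sup>2 \<le> x \<bullet> (W *v x)" for x
  proof (cases "x = 0")
    case False
    let ?y = "(1 / norm x) *\<^sub>R x"
    have "?l \<le> ?y \<bullet> (W *v ?y)" using False by (intro u(2)) auto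
    also have "\<dots> = x \<bullet> (W *v x) / (norm x)\<^sup>2"
      by (simp add: matrix_vector_mult_scaleR power2_eq_square)
    finally show ?thesis using False by (simp add: field_simps)
  qed auto
  ultimately show ?thesis by (rule that)
qed

text \<open>A fixed point \<open>X\<close> of \<open>X \<mapsto> (B + X\<^sup>2) / 2\<close> satisfies \<open>(1 - X)\<^sup>2 = 1 - B\<close>.\<close>

lemma blinfun_sqrt_near_id:
  fixes B :: "'a::{real_inner, banach, perfect_space} \<Rightarrow>\<^sub>L 'a"
  assumes B: "norm B \<le> q" "q < 1" and sym: "\<And>x y. B x \<bullet> y = x \<bullet> B y"
  obtains X :: "'a \<Rightarrow>\<^sub>L 'a" where "norm X \<le> q"
    "\<And>x y. blinfun_apply X x \<bullet> y = x \<bullet> blinfun_apply X y"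
    "\<And>C. B o\<^sub>L C = C o\<^sub>L B \<Longrightarrow> X o\<^sub>L C = C o\<^sub>L X"
    "2 *\<^sub>R X = B + (X o\<^sub>L X)"
proof -
  define f where "f X = (1/2) *\<^sub>R (B + (X o\<^sub>L X))" for X :: "'a \<Rightarrow>\<^sub>L 'a"
  \<comment> \<open>Banach's theorem is applied inside this set: symmetry and commuting with
    everything that commutes with \<open>B\<close> are closed conditions preserved by
    \<open>f\<close>, so the fixed point inherits them.\<close>
  define T where "T = {X::'a \<Rightarrow>\<^sub>L 'a. norm X \<le> q \<and> (\<forall>x y. blinfun_apply X x \<bullet> y = x \<bullet> blinfun_apply X y) \<and>
    (\<forall>C. B o\<^sub>L C = C o\<^sub>L B \<longrightarrow> X o\<^sub>L C = C o\<^sub>L X)}"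
  have q0: "0 \<le> q" using B(1) norm_ge_zero[of B] by linarith
  have 1: "closed T"
    unfolding T_def
    by (intro closed_Collect_conj closed_Collect_all closed_Collect_imp closed_Collect_le
        closed_Collect_eq continuous_intros) auto
  have 2: "f ` T \<subseteq> T"
  proof
    fix Y assume "Y \<in> f ` T"
    then obtain X where X: "X \<in> T" "Y = f X" by blast
    have "norm (X o\<^sub>L X) \<le> norm X * norm X" by (rule norm_blinfun_compose)
    also have "\<dots> \<le> q * 1" using X(1) B q0 by (intro mult_mono) (auto simp: T_def)
    finally have "norm (B + (X o\<^sub>L X)) \<le> q + q" using B(1) norm_triangle_ineq[of B "X o\<^sub>L X"] by linarith
    hence "norm Y \<le> q" by (simp add: X(2) f_def)
    moreover have "Y x \<bullet> y = x \<bullet> Y y" for x y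
    proof -
      have "X x \<bullet> y = x \<bullet> X y" for x y using X(1) by (simp add: T_def)
      thus ?thesis
        by (simp add: X(2) f_def plus_blinfun.rep_eq scaleR_blinfun.rep_eq inner_add sym)
    qed
    moreover have "Y o\<^sub>L C = C o\<^sub>L Y" if "B o\<^sub>L C = C o\<^sub>L B" for C
    proof (rule blinfun_eqI)
      fix x
      have "X o\<^sub>L C = C o\<^sub>L X" using X(1) that by (auto simp: T_def)
      hence "X (C z) = C (X z)" for z by (metis blinfun_apply_blinfun_compose)
      moreover have "B (C z) = C (B z)" for z using that by (metis blinfun_apply_blinfun_compose)
      ultimately show "(Y o\<^sub>L C) x = (C o\<^sub>L Y) x"
        by (simp add: X(2) f_def plus_blinfun.rep_eq scaleR_blinfun.rep_eq blinfun.add_right blinfun.scaleR_right)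
    qed
    ultimately show "Y \<in> T" by (auto simp: T_def)
  qed
  have 3: "dist (f X) (f Y) \<le> q * dist X Y" if "X \<in> T" "Y \<in> T" for X Y
  proof -
    \<comment> \<open>Noncommutative difference of squares: each summand is Lipschitz with constant
      \<open>q\<close>, and the factor 1/2 in \<open>f\<close> brings the sum back to
      \<open>q\<close>.\<close>
    have eq: "(X o\<^sub>L X) - (Y o\<^sub>L Y) = (X o\<^sub>L (X - Y)) + ((X - Y) o\<^sub>L Y)"
      by (simp add: bounded_bilinear.diff_left[OF bounded_bilinear_blinfun_compose]
          bounded_bilinear.diff_right[OF bounded_bilinear_blinfun_compose])
    have "norm ((X o\<^sub>L X) - (Y o\<^sub>L Y)) \<le> norm X * norm (X - Y) + norm (X - Y) * norm Y"
      unfolding eq by (rule order.trans[OF norm_triangle_ineq add_mono]) (rule norm_blinfun_compose)+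
    also have "\<dots> \<le> q * norm (X - Y) + norm (X - Y) * q"
      using that by (intro add_mono mult_mono) (auto simp: T_def q0)
    finally have "norm ((X o\<^sub>L X) - (Y o\<^sub>L Y)) / 2 \<le> q * norm (X - Y)" by (simp add: mult.commute)
    moreover have "f X - f Y = (1/2) *\<^sub>R ((X o\<^sub>L X) - (Y o\<^sub>L Y))"
      by (simp add: f_def algebra_simps)
    ultimately show ?thesis by (simp add: dist_norm)
  qed
  have "0 \<in> T" using q0 by (simp add: T_def)
  with 1 2 3 have "\<exists>!x\<in>T. f x = x"
    using Banach_fix[of T q f] q0 B(2) by (auto simp: complete_eq_closed)
  then obtain X where X: "X \<in> T" "f X = X" by blast
  have "B + (X o\<^sub>L X) = 2 *\<^sub>R f X" by (simp add: f_def)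
  hence "2 *\<^sub>R X = B + (X o\<^sub>L X)" using X(2) by simp
  show ?thesis
  proof (rule that[of X])
    show "norm X \<le> q" using X(1) by (simp add: T_def)
    show "X x \<bullet> y = x \<bullet> X y" for x y using X(1) by (simp add: T_def)
    show "X o\<^sub>L C = C o\<^sub>L X" if "B o\<^sub>L C = C o\<^sub>L B" for C
      using X(1) that unfolding T_def by blast
  qed fact
qed

text \<open>After scaling, W / c is close enough to the identity for a fixed point X with (1 - X)^2
  = W / c, and the root is sqrt c (1 - X). The commutation clause is what later forces
  uniqueness.\<close>

lemma posdef_sqrt_exists:
  fixes W :: "real^'k^'k"
  assumes W: "posdef W"
  obtains S where "posdef S" "S ** S = W" "\<And>C. W ** C = C ** W \<Longrightarrow> S ** C = C ** S"
proof -
  obtain l where l: "0 < l" "\<And>x. l * (norm x)\<^sup>2 \<le> x \<bullet> (W *v x)" using posdef_coercive[OF W] by blast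
  obtain K where K: "0 < K" "\<And>x. norm (W *v x) \<le> norm x * K"
    using bounded_linear.pos_bounded[OF matrix_vector_mul_bounded_linear[of W]] by blast
  have lK: "l \<le> K"
  proof -
    obtain x :: "real^'k" where x: "norm x = 1" using vector_choose_size[of 1] by auto
    have "l \<le> x \<bullet> (W *v x)" using l(2)[of x] x by simp
    also have "\<dots> \<le> norm x * norm (W *v x)" by (rule norm_cauchy_schwarz)
    also have "\<dots> \<le> K" using K(2)[of x] x by simp
    finally show ?thesis .
  qed
  \<comment> \<open>This value minimises 1 - 2 l / c + K^2 / c^2, a bound for the squared norm of 1
    - W / c; the minimum is q^2.\<close>
  define c where "c = K\<^sup>2 / l"
  have c: "0 < c" using K l by (simp add: c_def)
  define q where "q = sqrt (1 - l\<^sup>2 / K\<^sup>2)"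
  have lK2: "l\<^sup>2 / K\<^sup>2 \<le> 1" using lK l K by (simp add: power_mono)
  have q: "0 \<le> q" "q < 1" "q\<^sup>2 = 1 - l\<^sup>2 / K\<^sup>2" using lK2 l K by (auto simp: q_def)
  define B where "B = Blinfun (\<lambda>x. x - (1/c) *\<^sub>R (W *v x))"
  have Bx: "B x = x - (1/c) *\<^sub>R (W *v x)" for x
    unfolding B_def by (subst bounded_linear_Blinfun_apply)
      (auto intro!: bounded_linear_sub bounded_linear_ident bounded_linear_const_scaleR)
  have symW: "transpose W = W" using W by (simp add: posdef_def)
  have nB: "norm B \<le> q"
  proof (rule norm_blinfun_bound[OF q(1)])
    fix x
    have "(norm (B x))\<^sup>2 = (norm x)\<^sup>2 - 2 / c * (x \<bullet> (W *v x)) + (norm (W *v x))\<^sup>2 / c\<^sup>2"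
      unfolding Bx power2_norm_eq_inner
      by (simp add: inner_diff inner_commute power2_eq_square field_simps)
    also have "\<dots> \<le> (norm x)\<^sup>2 - 2 / c * (l * (norm x)\<^sup>2) + (norm x * K)\<^sup>2 / c\<^sup>2"
      using l(2)[of x] K(2)[of x] c
      by (intro add_mono diff_mono mult_left_mono divide_right_mono power_mono) auto
    also have "\<dots> = (norm x)\<^sup>2 * q\<^sup>2"
      using K(1) l(1) unfolding q(3) by (simp add: c_def field_simps power2_eq_square)
    finally have "(norm (B x))\<^sup>2 \<le> (q * norm x)\<^sup>2" by (simp add: power_mult_distrib mult.commute)
    thus "norm (B x) \<le> q * norm x" using q(1) by (auto intro: power2_le_imp_le)
  qed
  have symB: "B x \<bullet> y = x \<bullet> B y" for x y
    by (simp add: Bx inner_diff symmetric_matrix_move[OF symW])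
  obtain X :: "(real^'k) \<Rightarrow>\<^sub>L (real^'k)" where X: "norm X \<le> q"
    "\<And>x y. blinfun_apply X x \<bullet> y = x \<bullet> blinfun_apply X y"
    "\<And>C. B o\<^sub>L C = C o\<^sub>L B \<Longrightarrow> X o\<^sub>L C = C o\<^sub>L X" "2 *\<^sub>R X = B + (X o\<^sub>L X)"
    by (rule blinfun_sqrt_near_id[OF nB q(2) symB]) (rule that)
  define S :: "real^'k^'k" where "S = matrix (\<lambda>x. sqrt c *\<^sub>R (x - X x))"
  have lin: "linear (\<lambda>x. sqrt c *\<^sub>R (x - X x))"
    by (intro bounded_linear.linear bounded_linear_intros)
  have Sx: "S *v x = sqrt c *\<^sub>R (x - X x)" for x
    unfolding S_def using fun_cong[OF matrix_vector_mul(2)[OF lin]] by simp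
  have XX: "X (X x) = 2 *\<^sub>R X x - B x" for x
    using arg_cong[OF X(4), of "\<lambda>F. blinfun_apply F x"]
    by (simp add: plus_blinfun.rep_eq scaleR_blinfun.rep_eq)
  have "posdef S"
    unfolding posdef_def
  proof (intro conjI allI impI)
    have "(S *v x) \<bullet> y = x \<bullet> (S *v y)" for x y by (simp add: Sx inner_diff X(2))
    hence "(transpose S *v y) \<bullet> x = (S *v y) \<bullet> x" for x y
      by (metis dot_lmul_matrix transpose_matrix_vector)
    hence "transpose S *v y = S *v y" for y by (metis vector_eq_rdot)
    thus "transpose S = S" by (simp add: matrix_eq)
    fix x :: "real^'k" assume x: "x \<noteq> 0"
    have "x \<bullet> X x \<le> norm x * norm (X x)" by (rule norm_cauchy_schwarz)
    also have "\<dots> \<le> norm x * (q * norm x)"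
      by (intro mult_left_mono order.trans[OF norm_blinfun[of X x] mult_right_mono] X(1)) auto
    also have "\<dots> < 1 * (x \<bullet> x)"
      unfolding dot_square_norm using x q by (auto simp: power2_eq_square)
    finally show "0 < x \<bullet> (S *v x)" using c by (simp add: Sx inner_diff)
  qed
  moreover have "S ** S = W"
  proof -
    have "S *v (S *v x) = W *v x" for x
    proof -
      have "S *v (S *v x) = (sqrt c * sqrt c) *\<^sub>R (x - X x - (X x - X (X x)))"
        by (simp add: Sx blinfun.diff_right blinfun.scaleR_right flip: scaleR_diff_right)
      also have "x - X x - (X x - X (X x)) = (1/c) *\<^sub>R (W *v x)"
        by (simp add: XX Bx scaleR_2)
      finally show ?thesis using c by simp
    qed
    thus ?thesis by (simp add: matrix_eq matrix_vector_mul_assoc)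
  qed
  moreover have "S ** C = C ** S" if WC: "W ** C = C ** W" for C
  proof -
    define F where "F = Blinfun ((*v) C)"
    have F: "F x = C *v x" for x unfolding F_def by (simp add: bounded_linear_Blinfun_apply)
    have comm: "W *v (C *v x) = C *v (W *v x)" for x using WC by (simp add: matrix_vector_mul_assoc)
    have "B o\<^sub>L F = F o\<^sub>L B"
      by (rule blinfun_eqI)
        (simp add: Bx F comm matrix_vector_mult_diff_distrib matrix_vector_mult_scaleR)
    hence "X o\<^sub>L F = F o\<^sub>L X" by (rule X(3))
    hence "X (C *v x) = C *v (X x)" for x by (metis F blinfun_apply_blinfun_compose)
    hence "S *v (C *v x) = C *v (S *v x)" for x
      by (simp add: Sx matrix_vector_mult_diff_distrib matrix_vector_mult_scaleR)
    thus ?thesis by (simp add: matrix_eq matrix_vector_mul_assoc)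
  qed
  ultimately show ?thesis by (rule that)
qed

text \<open>The definite description needs uniqueness among all semidefinite roots. Another root T
  commutes with W = T T, hence with S, so (S + T)(S - T) = 0. Testing with y = S x - T x leaves y .
  S y + y . T y = 0, and definiteness of S gives y = 0.\<close>

lemma psd_sqrt_posdef:
  fixes W :: "real^'k^'k"
  assumes W: "posdef W"
  shows "posdef (psd_sqrt W)" "psd_sqrt W ** psd_sqrt W = W"
proof -
  obtain S where S: "posdef S" "S ** S = W" "\<And>C. W ** C = C ** W \<Longrightarrow> S ** C = C ** S"
    by (rule posdef_sqrt_exists[OF W]) (rule that)
  have nn: "0 \<le> x \<bullet> (S *v x)" for x using S(1) by (cases "x = 0") (auto simp: posdef_def intro: less_imp_le)
  have "psd_sqrt W = S"
    unfolding psd_sqrt_def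
  proof (rule the_equality)
    show "psd S \<and> S ** S = W" using S(1,2) nn by (auto simp: psd_def posdef_def)
    fix T assume T: "psd T \<and> T ** T = W"
    have "S ** T = T ** S" using T by (intro S(3)) (auto simp: matrix_mul_assoc)
    hence comm: "S *v (T *v x) = T *v (S *v x)" for x by (simp add: matrix_vector_mul_assoc)
    have sq: "S *v (S *v x) = T *v (T *v x)" for x using S(2) T by (simp add: matrix_vector_mul_assoc)
    have "S *v x = T *v x" for x
    proof -
      let ?y = "S *v x - T *v x"
      have "S *v ?y + T *v ?y = 0"
        by (simp add: matrix_vector_mult_diff_distrib comm sq)
      hence "?y \<bullet> (S *v ?y) + ?y \<bullet> (T *v ?y) = 0" by (simp flip: inner_add_right)
      moreover have "0 \<le> ?y \<bullet> (T *v ?y)" using T by (auto simp: psd_def)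
      ultimately have "\<not> 0 < ?y \<bullet> (S *v ?y)" by linarith
      hence "?y = 0" using S(1) unfolding posdef_def by blast
      thus ?thesis by simp
    qed
    thus "T = S" by (simp add: matrix_eq)
  qed
  thus "posdef (psd_sqrt W)" "psd_sqrt W ** psd_sqrt W = W" using S(1,2) by auto
qed

subsection \<open>Weighted norms\<close>

lemma posdef_symmetric: "posdef W \<Longrightarrow> transpose W = W"
  by (simp add: posdef_def)

lemma vector_matrix_mult_symmetric:
  fixes W :: "real^'k^'k"
  shows "transpose W = W \<Longrightarrow> x v* W = W *v x"
  by (metis transpose_matrix_vector)

lemma wprod_eq_inner: "wprod W X Y = (X ** W) \<bullet> Y"
  by (simp add: wprod_def trace_def inner_vec_def matrix_matrix_mult_def transpose_def)

context
  fixes W :: "real^'k^'k"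
  assumes W: "posdef W"
begin

text \<open>The root of \<open>W\<close> is an isometry from the \<open>W\<close>-metric to the
  Euclidean one, so the norm laws below are transported from Euclidean space.\<close>

lemma wip_eq_inner: "x \<bullet> (W *v y) = (psd_sqrt W *v x) \<bullet> (psd_sqrt W *v y)"
proof -
  have "W *v y = psd_sqrt W *v (psd_sqrt W *v y)"
    by (simp add: matrix_vector_mul_assoc psd_sqrt_posdef(2)[OF W])
  thus ?thesis
    by (simp add: symmetric_matrix_move[OF posdef_symmetric[OF psd_sqrt_posdef(1)[OF W]]])
qed

lemma wnorm_eq_norm: "wnorm W x = norm (psd_sqrt W *v x)"
  unfolding wnorm_def vector_matrix_mult_symmetric[OF posdef_symmetric[OF W]]
  by (simp add: inner_commute[of "W *v x" x] wip_eq_inner norm_eq_sqrt_inner)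

lemma wnorm_sq: "(wnorm W x)\<^sup>2 = x \<bullet> (W *v x)"
  by (simp add: wnorm_eq_norm wip_eq_inner power2_norm_eq_inner)

lemma wnorm_nonneg: "0 \<le> wnorm W x"
  by (simp add: wnorm_eq_norm)

lemma wnorm_zero [simp]: "wnorm W 0 = 0"
  by (simp add: wnorm_eq_norm)

lemma wnorm_eq_0: "wnorm W x = 0 \<longleftrightarrow> x = 0"
proof
  assume "wnorm W x = 0"
  hence "x \<bullet> (W *v x) = 0" using wnorm_sq[of x] by simp
  thus "x = 0" using W by (force simp: posdef_def)
qed simp

lemma wnorm_pos: "x \<noteq> 0 \<Longrightarrow> 0 < wnorm W x"
  using wnorm_nonneg[of x] wnorm_eq_0[of x] by linarith

lemma wip_commute: "x \<bullet> (W *v y) = y \<bullet> (W *v x)"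
  by (simp add: wip_eq_inner inner_commute)

lemma wip_Cauchy_Schwarz: "\<bar>x \<bullet> (W *v y)\<bar> \<le> wnorm W x * wnorm W y"
  by (simp add: wip_eq_inner wnorm_eq_norm Cauchy_Schwarz_ineq2)

lemma wnorm_triangle: "wnorm W (x + y) \<le> wnorm W x + wnorm W y"
  by (simp add: wnorm_eq_norm matrix_vector_right_distrib norm_triangle_ineq)

lemma wnorm_scaleR: "wnorm W (c *\<^sub>R x) = \<bar>c\<bar> * wnorm W x"
  by (simp add: wnorm_eq_norm matrix_vector_mult_scaleR)

lemma wnorm_diff_ineq: "\<bar>wnorm W x - wnorm W y\<bar> \<le> wnorm W (x - y)"
  by (simp add: wnorm_eq_norm matrix_vector_mult_diff_distrib norm_triangle_ineq3)

lemma wnorm2_eq_L2_set: "wnorm2 W X = L2_set (\<lambda>n. wnorm W (X $ n)) UNIV"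
  by (simp add: wnorm2_def L2_set_def)

lemma wnorm2_nonneg: "0 \<le> wnorm2 W X"
  by (simp add: wnorm2_eq_L2_set)

lemma wnorm2_sq: "(wnorm2 W X)\<^sup>2 = (\<Sum>n\<in>UNIV. (wnorm W (X $ n))\<^sup>2)"
  by (simp add: wnorm2_def sum_nonneg)

lemma wnorm2_eq_0: "wnorm2 W X = 0 \<longleftrightarrow> X = 0"
  by (simp add: wnorm2_eq_L2_set L2_set_eq_0_iff wnorm_eq_0 vec_eq_iff)

lemma wnorm_row_le_wnorm2: "wnorm W (X $ n) \<le> wnorm2 W X"
  unfolding wnorm2_eq_L2_set by (rule member_le_L2_set) auto

lemma wprod_eq_sum: "wprod W X Y = (\<Sum>n\<in>UNIV. X $ n \<bullet> (W *v Y $ n))"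
proof -
  have "(X ** W) $ n = X $ n v* W" for n
    by (simp add: matrix_matrix_mult_def vector_matrix_mult_def vec_eq_iff)
  thus ?thesis
    by (simp add: wprod_eq_inner inner_vec_def[of "X ** W" Y] dot_lmul_matrix)
qed

lemma wprod_self: "wprod W X X = (wnorm2 W X)\<^sup>2"
  by (simp add: wprod_eq_sum wnorm2_sq wnorm_sq)

lemma wprod_Cauchy_Schwarz: "\<bar>wprod W X Y\<bar> \<le> wnorm2 W X * wnorm2 W Y"
proof -
  have "\<bar>wprod W X Y\<bar> \<le> (\<Sum>n\<in>UNIV. \<bar>wnorm W (X $ n)\<bar> * \<bar>wnorm W (Y $ n)\<bar>)"
    unfolding wprod_eq_sum
    using wip_Cauchy_Schwarz by (intro order.trans[OF sum_abs] sum_mono) (simp add: wnorm_nonneg)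
  also have "\<dots> \<le> wnorm2 W X * wnorm2 W Y"
    unfolding wnorm2_eq_L2_set by (rule L2_set_mult_ineq)
  finally show ?thesis .
qed

text \<open>Entry n of the vector on the left is the \<open>W\<close>-inner product of row n of
  \<open>X\<close> with \<open>y\<close>, so Cauchy-Schwarz applies row by row.\<close>

lemma norm_matrix_weight_vector_le: "norm (X *v (W *v y)) \<le> wnorm2 W X * wnorm W y"
proof -
  have "norm (X *v (W *v y)) \<le> L2_set (\<lambda>n. wnorm W (X $ n) * wnorm W y) UNIV"
    unfolding norm_vec_def
    by (intro L2_set_mono) (simp_all add: matrix_vector_mul_component wip_Cauchy_Schwarz)
  thus ?thesis
    by (simp add: wnorm2_eq_L2_set L2_set_left_distrib wnorm_nonneg)
qed

lemma wnorm1_le_wnorm2: "wnorm1 W X \<le> real CARD('n) * wnorm2 W X" for X :: "real^'k^'n"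
  unfolding wnorm1_def
  using sum_bounded_above[of UNIV "\<lambda>n. wnorm W (X $ n)", OF wnorm_row_le_wnorm2] by simp

end

lemma wprod_diff_left: "wprod W (X - Y) Z = wprod W X Z - wprod W Y Z"
  by (simp add: wprod_eq_inner matrix_matrix_mult_def inner_vec_def
      sum_subtractf algebra_simps)

lemma wprod_diff_right: "wprod W X (Y - Z) = wprod W X Y - wprod W X Z"
  by (simp add: wprod_eq_inner inner_diff_right)

lemma wprod_scaleR_left: "wprod W (c *\<^sub>R X) Y = c * wprod W X Y"
  by (simp add: wprod_eq_inner matrix_matrix_mult_def inner_vec_def
      sum_distrib_left algebra_simps)

subsection \<open>The proximal map\<close>

text \<open>Block soft thresholding in the \<open>W\<close>-norm: the proximal map of
  \<open>s * wnorm W\<close> on a single row.\<close>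

definition shrink :: "real^'k^'k \<Rightarrow> real \<Rightarrow> real^'k \<Rightarrow> real^'k" where
  "shrink W s p = (if wnorm W p \<le> s then 0 else (1 - s / wnorm W p) *\<^sub>R p)"

text \<open>Both cases reduce to Cauchy-Schwarz for \<open>p\<close> and \<open>x\<close>: with q
  the shrunk vector, p - q is either p itself, of norm at most s, or p rescaled to norm s. Hence (p
  - q) / s is a subgradient of the norm at q.\<close>

lemma shrink_variational:
  assumes W: "posdef W" and s: "0 < s"
  shows "(p - shrink W s p) \<bullet> (W *v (x - shrink W s p)) \<le> s * (wnorm W x - wnorm W (shrink W s p))"
proof (cases "wnorm W p \<le> s")
  case True
  have "p \<bullet> (W *v x) \<le> wnorm W p * wnorm W x" using wip_Cauchy_Schwarz[OF W, of p x] by linarith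
  also have "\<dots> \<le> s * wnorm W x" using True wnorm_nonneg[OF W] by (intro mult_right_mono)
  finally show ?thesis using True by (simp add: shrink_def W)
next
  case False
  define w where "w = wnorm W p"
  have w: "s < w" "0 < w" using False s by (auto simp: w_def)
  have z: "shrink W s p = (1 - s / w) *\<^sub>R p" using False by (simp add: shrink_def w_def)
  have pz: "p - shrink W s p = (s / w) *\<^sub>R p" by (simp add: z algebra_simps)
  have nz: "wnorm W (shrink W s p) = w - s"
    using w by (simp add: z wnorm_scaleR[OF W] w_def[symmetric] field_simps)
  have "(p - shrink W s p) \<bullet> (W *v (x - shrink W s p)) = s / w * (p \<bullet> (W *v x) - (1 - s / w) * w\<^sup>2)"
    unfolding pz unfolding z
    by (simp add: matrix_vector_mult_diff_distrib matrix_vector_mult_scaleR inner_diff_right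
        w_def wnorm_sq[OF W] right_diff_distrib diff_divide_distrib)
  also have "\<dots> \<le> s / w * (w * wnorm W x - (1 - s / w) * w\<^sup>2)"
    using wip_Cauchy_Schwarz[OF W, of p x] w s by (intro mult_left_mono) (auto simp: w_def)
  also have "\<dots> = s * (wnorm W x - wnorm W (shrink W s p))"
    using w unfolding nz by (simp add: field_simps power2_eq_square)
  finally show ?thesis .
qed

text \<open>Strong convexity: the value at any Z exceeds the value at \<open>?Q\<close> by at least
  the squared distance over 2 s. So a minimiser exists, and the choice made by
  \<open>ARG_MIN\<close> can only be \<open>?Q\<close>.\<close>

lemma prox_eq_shrink:
  fixes W :: "real^'k^'k" and P :: "real^'k^'n"
  assumes W: "posdef W" and s: "0 < s"
  shows "prox W s P = (\<chi> n. shrink W s (P $ n))"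
proof -
  let ?F = "\<lambda>Z. wnorm1 W Z + 1 / (2 * s) * (wnorm2 W (Z - P))\<^sup>2"
  let ?Q = "(\<chi> n. shrink W s (P $ n)) :: real^'k^'n"
  have row: "wnorm W (?Q $ n) + 1 / (2 * s) * (wnorm W ((?Q - P) $ n))\<^sup>2 + 1 / (2 * s) * (wnorm W ((Z - ?Q) $ n))\<^sup>2
      \<le> wnorm W (Z $ n) + 1 / (2 * s) * (wnorm W ((Z - P) $ n))\<^sup>2" for Z :: "real^'k^'n" and n
  proof -
    let ?q = "shrink W s (P $ n)" and ?p = "P $ n" and ?z = "Z $ n"
    \<comment> \<open>The square is expanded around the shrunk row; the cross term is the one
      controlled by the variational inequality.\<close>
    have "(wnorm W (?z - ?p))\<^sup>2 = (wnorm W (?z - ?q))\<^sup>2 + (wnorm W (?q - ?p))\<^sup>2 - 2 * ((?p - ?q) \<bullet> (W *v (?z - ?q)))"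
      unfolding wnorm_sq[OF W]
      by (simp add: matrix_vector_mult_diff_distrib inner_diff wip_commute[OF W, of ?p ?z] wip_commute[OF W, of ?p ?q]
          wip_commute[OF W, of ?q ?z])
    hence "1 / (2 * s) * (wnorm W (?z - ?p))\<^sup>2 = 1 / (2 * s) * (wnorm W (?z - ?q))\<^sup>2
        + 1 / (2 * s) * (wnorm W (?q - ?p))\<^sup>2 - ((?p - ?q) \<bullet> (W *v (?z - ?q))) / s"
      using s by (simp add: diff_divide_distrib add_divide_distrib)
    moreover have "((?p - ?q) \<bullet> (W *v (?z - ?q))) / s \<le> wnorm W ?z - wnorm W ?q"
      using shrink_variational[OF W s, of ?p ?z] s by (simp add: pos_divide_le_eq mult.commute)
    ultimately show ?thesis by simp
  qed
  have strong: "?F ?Q + 1 / (2 * s) * (wnorm2 W (Z - ?Q))\<^sup>2 \<le> ?F Z" for Z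
    unfolding wnorm1_def wnorm2_sq[OF W] sum_distrib_left sum.distrib[symmetric]
    by (intro sum_mono row)
  have "is_arg_min ?F (\<lambda>_. True) ?Q"
    unfolding is_arg_min_linorder
  proof (intro conjI allI impI TrueI)
    fix Z show "?F ?Q \<le> ?F Z"
      using strong[of Z] s by (smt (verit) divide_nonneg_pos mult_nonneg_nonneg zero_le_power2)
  qed
  hence "is_arg_min ?F (\<lambda>_. True) (prox W s P)"
    unfolding prox_def arg_min_def by (rule someI)
  hence "?F (prox W s P) \<le> ?F ?Q" by (simp add: is_arg_min_linorder)
  hence "1 / (2 * s) * (wnorm2 W (prox W s P - ?Q))\<^sup>2 \<le> 0" using strong[of "prox W s P"] by linarith
  hence "wnorm2 W (prox W s P - ?Q) = 0" using s by (simp add: divide_le_0_iff)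
  thus ?thesis by (simp add: wnorm2_eq_0[OF W])
qed

lemma prox_variational:
  fixes P :: "real^'k^'n"
  assumes W: "posdef W" and s: "0 < s"
  shows "wprod W (P - prox W s P) (X - prox W s P) \<le> s * (wnorm1 W X - wnorm1 W (prox W s P))"
  unfolding wprod_eq_sum[OF W] wnorm1_def prox_eq_shrink[OF W s] sum_subtractf[symmetric] sum_distrib_left
  by (intro sum_mono) (simp add: shrink_variational[OF W s])

subsection \<open>The weight matrix\<close>

lemma posdef_invertible: "posdef W \<Longrightarrow> invertible W"
  unfolding invertible_left_inverse matrix_left_invertible_ker posdef_def
  by (metis inner_zero_right less_irrefl)

lemma
  fixes M :: "real^'k^'k"
  assumes "invertible M"
  shows matrix_inv_left: "matrix_inv M ** M = mat 1"
    and matrix_inv_right: "M ** matrix_inv M = mat 1"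
  using someI_ex[OF assms[unfolded invertible_def]] by (auto simp: matrix_inv_def)

lemma matrix_inv_unique:
  fixes M :: "real^'k^'k"
  assumes "M ** X = mat 1"
  shows "matrix_inv M = X"
proof -
  have "X ** M = mat 1" using assms by (simp add: matrix_left_right_inverse)
  hence "invertible M" using assms by (auto simp: invertible_def)
  hence "matrix_inv M ** M ** X = X" by (simp add: matrix_inv_left)
  thus ?thesis using assms by (simp flip: matrix_mul_assoc)
qed

lemma
  fixes M :: "real^'k^'k"
  assumes M: "posdef M"
  shows posdef_inv_apply: "M *v (matrix_inv M *v x) = x" "matrix_inv M *v (M *v x) = x"
    and posdef_matrix_inv: "posdef (matrix_inv M)"
proof -
  have i: "invertible M" using M by (rule posdef_invertible)
  show 1: "M *v (matrix_inv M *v x) = x" "matrix_inv M *v (M *v x) = x" for x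
    by (simp_all add: matrix_vector_mul_assoc matrix_inv_left[OF i] matrix_inv_right[OF i])
  have "transpose (matrix_inv M ** M) = mat 1" by (simp add: matrix_inv_left[OF i])
  hence "M ** transpose (matrix_inv M) = mat 1" using posdef_symmetric[OF M] by (simp add: matrix_transpose_mul)
  hence "matrix_inv M = transpose (matrix_inv M)" by (rule matrix_inv_unique)
  moreover have "0 < x \<bullet> (matrix_inv M *v x)" if "x \<noteq> 0" for x
  proof -
    let ?y = "matrix_inv M *v x"
    have "?y \<noteq> 0" using 1(1)[of x] that by auto
    hence "0 < ?y \<bullet> (M *v ?y)" using M by (auto simp: posdef_def)
    thus ?thesis by (simp add: 1 inner_commute)
  qed
  ultimately show "posdef (matrix_inv M)" by (simp add: posdef_def)
qed

text \<open>Multiplying M X M = M by the inverse on both sides determines X, which settles the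
  definite description.\<close>

lemma pinv_eq_matrix_inv:
  fixes M :: "real^'k^'k"
  assumes i: "invertible M"
  shows "pinv M = matrix_inv M"
  unfolding pinv_def
proof (rule the_equality)
  show "is_pinv M (matrix_inv M)"
    by (simp add: is_pinv_def matrix_inv_left[OF i] matrix_inv_right[OF i])
  fix X assume "is_pinv M X"
  hence "matrix_inv M ** (M ** X ** M) ** matrix_inv M = matrix_inv M ** M ** matrix_inv M"
    by (simp add: is_pinv_def)
  hence "matrix_inv M ** M ** X ** (M ** matrix_inv M) = matrix_inv M"
    by (simp add: matrix_mul_assoc matrix_inv_left[OF i])
  thus "X = matrix_inv M" by (simp add: matrix_inv_left[OF i] matrix_inv_right[OF i])
qed

lemma gram_apply:
  "gram \<gamma> Z *v y = \<gamma> *\<^sub>R y + (1 - \<gamma>) *\<^sub>R (transpose Z *v (Z *v y))"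
  by (simp add: gram_def matrix_vector_mult_add_rdistrib matrix_vector_mul_assoc
      del: transpose_matrix_vector flip: scaleR_matrix_vector_assoc)

lemma gram_form:
  "x \<bullet> (gram \<gamma> Z *v y) = \<gamma> * (x \<bullet> y) + (1 - \<gamma>) * ((Z *v x) \<bullet> (Z *v y))"
  by (simp add: gram_apply inner_add_right inner_commute[of x] dot_lmul_matrix)
   (simp add: inner_commute)

lemma transpose_gram:
  fixes Z :: "real^'k^'n"
  shows "transpose (gram \<gamma> Z) = gram \<gamma> Z"
proof -
  have "transpose (A + B) = transpose A + transpose B" for A B :: "real^'k^'k"
    by (simp add: transpose_def vec_eq_iff)
  thus ?thesis by (simp add: gram_def transpose_scalar matrix_transpose_mul)
qed

text \<open>The form is a sum of two nonnegative terms. If it vanishes at x, both do, so the Gram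
  matrix sends x to 0, which invertibility excludes.\<close>

lemma posdef_gram:
  fixes Z :: "real^'k^'n"
  assumes \<gamma>: "0 \<le> \<gamma>" "\<gamma> \<le> 1" and i: "invertible (gram \<gamma> Z)"
  shows "posdef (gram \<gamma> Z)"
  unfolding posdef_def
proof (intro conjI allI impI transpose_gram)
  fix x :: "real^'k" assume "x \<noteq> 0"
  hence nz: "gram \<gamma> Z *v x \<noteq> 0"
    using i unfolding invertible_left_inverse matrix_left_invertible_ker by blast
  have "0 \<le> x \<bullet> (gram \<gamma> Z *v x)" using \<gamma> by (simp add: gram_form)
  moreover have False if "x \<bullet> (gram \<gamma> Z *v x) = 0"
  proof -
    have "\<gamma> * (x \<bullet> x) = 0 \<and> (1 - \<gamma>) * ((Z *v x) \<bullet> (Z *v x)) = 0"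
      using that \<gamma> unfolding gram_form by (subst (asm) add_nonneg_eq_0_iff) auto
    hence "gram \<gamma> Z *v x = 0" by (auto simp: gram_apply)
    thus False using nz by blast
  qed
  ultimately show "0 < x \<bullet> (gram \<gamma> Z *v x)" by fastforce
qed

lemma invertible_gram:
  fixes Z :: "real^'k^'n"
  assumes \<gamma>: "0 \<le> \<gamma>" "\<gamma> \<le> 1" and i: "0 < \<gamma> \<or> invertible (transpose Z ** Z)"
  shows "invertible (gram \<gamma> Z)"
proof (cases "\<gamma> = 0")
  case True
  thus ?thesis using i by (simp add: gram_def)
next
  case False
  have "0 < x \<bullet> (gram \<gamma> Z *v x)" if "x \<noteq> 0" for x
    using that \<gamma> False by (simp add: gram_form add_pos_nonneg)
  thus ?thesis by (intro posdef_invertible) (simp add: posdef_def transpose_gram)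
qed

text \<open>Row n of the product is the root of the weight applied to row n, and the Euclidean norm
  of that is the weighted norm. This replaces the pseudo-inverse and its root by the weight.\<close>

lemma Psi_eq_wnorm1:
  fixes Z :: "real^'k^'n"
  assumes \<gamma>: "0 \<le> \<gamma>" "\<gamma> \<le> 1" and i: "invertible (gram \<gamma> Z)"
  shows "Psi \<gamma> Z = wnorm1 (weight \<gamma> Z) Z"
proof -
  have W: "posdef (weight \<gamma> Z)"
    unfolding weight_def by (intro posdef_matrix_inv posdef_gram \<gamma> i)
  have "(Z ** psd_sqrt (weight \<gamma> Z)) $ n = psd_sqrt (weight \<gamma> Z) *v Z $ n" for n
  proof -
    have "(Z ** psd_sqrt (weight \<gamma> Z)) $ n = Z $ n v* psd_sqrt (weight \<gamma> Z)"
      by (simp add: matrix_matrix_mult_def vector_matrix_mult_def vec_eq_iff)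
    thus ?thesis
      by (simp add: vector_matrix_mult_symmetric posdef_symmetric psd_sqrt_posdef(1)[OF W])
  qed
  thus ?thesis
    by (simp add: Psi_def norm21_def wnorm1_def pinv_eq_matrix_inv[OF i] wnorm_eq_norm[OF W]
        flip: weight_def)
qed

subsection \<open>Second-order expansion of the regulariser\<close>

text \<open>The derivative at D = 0, in direction X, of
  \<open>wnorm1 (weight \<gamma> (Z + D)) Z\<close>: the rows are frozen and only the weight moves.
  A zero row contributes 0.\<close>

definition dPsi :: "real \<Rightarrow> real^'k^'n \<Rightarrow> real^'k^'n \<Rightarrow> real" where
  "dPsi \<gamma> Z X = - (\<Sum>n\<in>UNIV. (1 - \<gamma>) / wnorm (weight \<gamma> Z) (Z $ n) *
     ((Z *v (weight \<gamma> Z *v Z $ n)) \<bullet> (X *v (weight \<gamma> Z *v Z $ n))))"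

lemma rank1_apply:
  assumes W: "posdef W"
  shows "rank1 W z *v y = (z \<bullet> (W *v y)) *\<^sub>R (W *v z)"
proof -
  have "(columnvector z :: real^1^'a) *v ((rowvector z :: real^'a^1) *v u) = (z \<bullet> u) *\<^sub>R z" for u
    by (simp add: vec_eq_iff matrix_vector_mult_def columnvector_def rowvector_def inner_vec_def)
  thus ?thesis
    by (simp add: rank1_def matrix_vector_mult_scaleR flip: matrix_vector_mul_assoc)
qed

lemma sum_matrix_vector_mult:
  fixes f :: "'i \<Rightarrow> real^'k^'n"
  shows "(\<Sum>i\<in>I. f i) *v y = (\<Sum>i\<in>I. f i *v y)"
  by (induction I rule: infinite_finite_induct) (simp_all add: matrix_vector_mult_add_rdistrib)

lemma uminus_matrix_vector_mult: "(- A) *v y = - (A *v y)" for A :: "real^'k^'n"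
  by (simp add: vec_eq_iff matrix_vector_mul_component)

lemma Lam_apply:
  fixes Z :: "real^'k^'n"
  assumes W: "posdef (weight \<gamma> Z)"
  shows "Lam \<gamma> Z *v y = - (\<Sum>n\<in>UNIV. ((1 - \<gamma>) / wnorm (weight \<gamma> Z) (Z $ n) * (Z $ n \<bullet> (weight \<gamma> Z *v y)))
           *\<^sub>R (weight \<gamma> Z *v Z $ n))"
proof -
  have "Lam \<gamma> Z *v y = - (\<Sum>n\<in>{n. Z $ n \<noteq> 0}. ((1 - \<gamma>) / wnorm (weight \<gamma> Z) (Z $ n) * (Z $ n \<bullet> (weight \<gamma> Z *v y)))
           *\<^sub>R (weight \<gamma> Z *v Z $ n))"
    by (simp add: Lam_def Let_def sum_matrix_vector_mult rank1_apply[OF W] uminus_matrix_vector_mult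
        flip: scaleR_matrix_vector_assoc)
  \<comment> \<open>Zero rows may join the sum, because \<open>weight \<gamma> Z *v Z $ n\<close> is
    then 0.\<close>
  also have "\<dots> = - (\<Sum>n\<in>UNIV. ((1 - \<gamma>) / wnorm (weight \<gamma> Z) (Z $ n) * (Z $ n \<bullet> (weight \<gamma> Z *v y)))
           *\<^sub>R (weight \<gamma> Z *v Z $ n))"
    by (intro arg_cong[of _ _ uminus] sum.mono_neutral_left) auto
  finally show ?thesis .
qed

lemma matrix_mult_row: "(A ** B) $ n = A $ n v* B"
  by (simp add: matrix_matrix_mult_def vector_matrix_mult_def vec_eq_iff)

text \<open>Exchanging the two sums over rows shows that \<open>Z ** Lam \<gamma> Z\<close> is the
  Frobenius gradient of the contribution of the moving weight.\<close>

lemma inner_Lam_eq_dPsi: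
  fixes Z X :: "real^'k^'n"
  assumes W: "posdef (weight \<gamma> Z)"
  shows "(Z ** Lam \<gamma> Z) \<bullet> X = dPsi \<gamma> Z X"
proof -
  let ?W = "weight \<gamma> Z"
  define c where "c n = (1 - \<gamma>) / wnorm ?W (Z $ n)" for n
  have "(Z ** Lam \<gamma> Z) \<bullet> X = (\<Sum>m\<in>UNIV. Z $ m \<bullet> (Lam \<gamma> Z *v X $ m))"
    by (simp add: inner_vec_def[of "_ ** _"] matrix_mult_row dot_lmul_matrix)
  also have "\<dots> = - (\<Sum>m\<in>UNIV. \<Sum>n\<in>UNIV. c n * ((Z $ m \<bullet> (?W *v Z $ n)) * (X $ m \<bullet> (?W *v Z $ n))))"
    by (simp add: Lam_apply[OF W] inner_sum_right sum_negf c_def wip_commute[OF W, of "Z $ _" "X $ _"] mult_ac)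
  also have "\<dots> = - (\<Sum>n\<in>UNIV. c n * (\<Sum>m\<in>UNIV. (Z $ m \<bullet> (?W *v Z $ n)) * (X $ m \<bullet> (?W *v Z $ n))))"
    by (subst sum.swap) (simp add: sum_distrib_left)
  also have "\<dots> = dPsi \<gamma> Z X"
    by (simp add: dPsi_def c_def inner_vec_def[of "_ *v (_ *v _)"] matrix_vector_mul_component)
  finally show ?thesis .
qed

lemma norm_matrix_vector_le: "norm (X *v y) \<le> norm X * norm y" for X :: "real^'k^'n"
proof -
  have "norm (X *v y) \<le> L2_set (\<lambda>n. norm (X $ n) * norm y) UNIV"
    unfolding norm_vec_def[of "X *v y"]
    by (intro L2_set_mono) (simp_all add: matrix_vector_mul_component Cauchy_Schwarz_ineq2)
  thus ?thesis
    by (simp add: norm_vec_def[of X] L2_set_left_distrib)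
qed

section \<open>Perturbation of the Gram form\<close>

definition gram_pert :: "real \<Rightarrow> real^'k^'n \<Rightarrow> real^'k^'n \<Rightarrow> real^'k \<Rightarrow> real^'k \<Rightarrow> real" where
  "gram_pert \<gamma> Z D u v =
     (1 - \<gamma>) * ((Z *v u) \<bullet> (D *v v) + (D *v u) \<bullet> (Z *v v) + (D *v u) \<bullet> (D *v v))"

lemma gram_form_add:
  "u \<bullet> (gram \<gamma> (Z + D) *v v) = u \<bullet> (gram \<gamma> Z *v v) + gram_pert \<gamma> Z D u v"
  by (simp add: gram_form gram_pert_def matrix_vector_mult_add_rdistrib inner_add algebra_simps)

text \<open>The difference splits as e(x - y, x/|x|) + e(y, x/|x| - y/|y|), and |y| times the
  difference of the unit vectors is at most 2 |x - y|; hence 3 = 1 + 2. This allows moving a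
  first-order term from a row of Z + D to the row of Z, even when one of them is 0.\<close>

lemma quotient_form_lipschitz:
  fixes e :: "real^'k \<Rightarrow> real^'k \<Rightarrow> real"
  assumes W: "posdef W"
    and l: "\<And>x y z. e (x - y) z = e x z - e y z" and r: "\<And>x y z. e z (x - y) = e z x - e z y"
    and rs: "\<And>c x y. e x (c *\<^sub>R y) = c * e x y"
    and b: "\<And>x y. \<bar>e x y\<bar> \<le> k * wnorm W x * wnorm W y"
  shows "\<bar>e x x / wnorm W x - e y y / wnorm W y\<bar> \<le> 3 * k * wnorm W (x - y)"
proof -
  have b0: "e 0 0 = 0" using l[of 0 0 0] by simp
  have q: "\<bar>e z z / wnorm W z\<bar> \<le> k * wnorm W z" for z
    using b[of z z] wnorm_pos[OF W, of z] b0 by (cases "z = 0") (auto simp: abs_div field_simps W)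
  have sym: "wnorm W (- z) = wnorm W z" for z using wnorm_scaleR[OF W, of "-1" z] by simp
  have k: "0 \<le> k"
  proof -
    obtain v :: "real^'k" where v: "v \<noteq> 0" by (metis vector_choose_size[of 1] norm_zero zero_neq_one zero_le_one)
    have "0 \<le> k * (wnorm W v * wnorm W v)" using b[of v v] by (simp add: mult.assoc)
    moreover have "0 < wnorm W v * wnorm W v" using wnorm_pos[OF W v] by simp
    ultimately show ?thesis by (metis mult_neg_pos not_le)
  qed
  show ?thesis
  proof (cases "x = 0 \<or> y = 0")
    case True
    have "0 \<le> k * wnorm W (x - y)" using k wnorm_nonneg[OF W] by simp
    thus ?thesis using True q[of x] q[of y] by (auto simp: b0 W sym)
  next
    case False
    define a where "a = wnorm W x"
    define c where "c = wnorm W y"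
    have ac: "0 < a" "0 < c" using False wnorm_pos[OF W] by (auto simp: a_def c_def)
    let ?w = "(1 / a) *\<^sub>R x - (1 / c) *\<^sub>R y"
    have ca: "\<bar>c - a\<bar> \<le> wnorm W (x - y)"
      using wnorm_diff_ineq[OF W, of x y] by (simp add: a_def c_def abs_minus_commute)
    have "c *\<^sub>R ?w = (x - y) + ((c - a) / a) *\<^sub>R x"
      using ac by (simp add: algebra_simps diff_divide_distrib)
    hence "c * wnorm W ?w \<le> wnorm W (x - y) + wnorm W (((c - a) / a) *\<^sub>R x)"
      using wnorm_triangle[OF W, of "x - y" "((c - a) / a) *\<^sub>R x"] wnorm_scaleR[OF W, of c ?w] ac by simp
    also have "\<dots> \<le> 2 * wnorm W (x - y)"
      using ca ac by (simp add: wnorm_scaleR[OF W] a_def[symmetric])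
    finally have cw: "c * wnorm W ?w \<le> 2 * wnorm W (x - y)" .
    have "e x x / a - e y y / c = e (x - y) x / a + e y ?w"
      using ac by (simp add: l r rs diff_divide_distrib)
    hence "\<bar>e x x / a - e y y / c\<bar> \<le> \<bar>e (x - y) x\<bar> / a + \<bar>e y ?w\<bar>"
      using abs_triangle_ineq[of "e (x - y) x / a" "e y ?w"] ac by simp
    also have "\<dots> \<le> k * wnorm W (x - y) + k * (c * wnorm W ?w)"
      using b[of "x - y" x] b[of y ?w] ac
      by (intro add_mono) (simp_all add: a_def[symmetric] c_def[symmetric] pos_divide_le_eq mult.assoc)
    also have "\<dots> \<le> k * wnorm W (x - y) + k * (2 * wnorm W (x - y))"
      using cw k by (intro add_mono mult_left_mono) auto
    finally show ?thesis by (simp add: a_def c_def)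
  qed
qed

section \<open>Uniform estimates in the metric of the current weight\<close>

context
  fixes \<gamma> :: real and Z D :: "real^'k^'n" and W :: "real^'k^'k" and d :: real
  assumes \<gamma>: "0 \<le> \<gamma>" "\<gamma> \<le> 1" and i: "invertible (gram \<gamma> Z)"
  defines "W \<equiv> weight \<gamma> Z" and "d \<equiv> wnorm2 W D"
begin

lemma posdef_weight: "posdef W"
  unfolding W_def weight_def by (intro posdef_matrix_inv posdef_gram \<gamma> i)

lemma gram_weight_apply: "gram \<gamma> Z *v (W *v x) = x" "W *v (gram \<gamma> Z *v x) = x"
  unfolding W_def weight_def by (intro posdef_inv_apply posdef_gram \<gamma> i)+

lemma weighted_size_nonneg: "0 \<le> d"
  unfolding d_def by (rule wnorm2_nonneg[OF posdef_weight])

text \<open>Tested at W x, the Gram form equals the squared weighted norm of x and dominates its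
  second part. The factor \<open>sqrt (1 - \<gamma>)\<close> is kept in the bound, since for
  \<gamma> = 1 the form does not see Z.\<close>

lemma norm_Z_weight_le: "sqrt (1 - \<gamma>) * norm (Z *v (W *v x)) \<le> wnorm W x"
proof (rule power2_le_imp_le)
  have "(wnorm W x)\<^sup>2 = (W *v x) \<bullet> (gram \<gamma> Z *v (W *v x))"
    by (simp add: wnorm_sq[OF posdef_weight] gram_weight_apply inner_commute)
  also have "\<dots> \<ge> (1 - \<gamma>) * (norm (Z *v (W *v x)))\<^sup>2"
    unfolding gram_form using \<gamma> by (simp add: power2_norm_eq_inner)
  finally show "(sqrt (1 - \<gamma>) * norm (Z *v (W *v x)))\<^sup>2 \<le> (wnorm W x)\<^sup>2"
    using \<gamma> by (simp add: power_mult_distrib)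
qed (rule wnorm_nonneg[OF posdef_weight])

lemma norm_D_weight_le: "norm (D *v (W *v x)) \<le> d * wnorm W x"
  unfolding d_def by (rule norm_matrix_weight_vector_le[OF posdef_weight])

lemma sqrt_norm_D_weight_le: "sqrt (1 - \<gamma>) * norm (D *v (W *v x)) \<le> d * wnorm W x"
proof -
  have "sqrt (1 - \<gamma>) * norm (D *v (W *v x)) \<le> 1 * norm (D *v (W *v x))"
    using \<gamma> by (intro mult_right_mono) auto
  thus ?thesis using norm_D_weight_le[of x] by simp
qed

text \<open>The factor 1 - \<gamma> is split into two square roots, one for each argument, to match
  the scaled bounds above.\<close>

lemma inner_scaled_le:
  fixes u v :: "'a::real_inner"
  assumes "sqrt (1 - \<gamma>) * norm u \<le> p" "sqrt (1 - \<gamma>) * norm v \<le> q"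
  shows "\<bar>(1 - \<gamma>) * (u \<bullet> v)\<bar> \<le> p * q"
proof -
  have "\<bar>(1 - \<gamma>) * (u \<bullet> v)\<bar> = (1 - \<gamma>) * \<bar>u \<bullet> v\<bar>" using \<gamma> by (simp add: abs_mult)
  also have "\<dots> \<le> (1 - \<gamma>) * (norm u * norm v)"
    using \<gamma> by (intro mult_left_mono Cauchy_Schwarz_ineq2) auto
  also have "\<dots> = (sqrt (1 - \<gamma>) * norm u) * (sqrt (1 - \<gamma>) * norm v)" using \<gamma> by simp
  also have "\<dots> \<le> p * q"
    using \<gamma> assms by (intro mult_mono) (auto intro: order.trans[rotated] mult_nonneg_nonneg)
  finally show ?thesis .
qed

text \<open>The inner product is quadratic in the row, so one factor \<open>wnorm W (Z $ n)\<close>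
  survives the division. This decay later gives continuity of \<open>dmodel\<close> where a row
  vanishes.\<close>

lemma abs_dPsi_term_le:
  "\<bar>(1 - \<gamma>) / wnorm W (Z $ n) * ((Z *v (W *v Z $ n)) \<bullet> (D *v (W *v Z $ n)))\<bar> \<le> d * wnorm W (Z $ n)"
proof (cases "Z $ n = 0")
  case False
  let ?a = "wnorm W (Z $ n)"
  have a: "0 < ?a" using False by (rule wnorm_pos[OF posdef_weight])
  have "\<bar>(1 - \<gamma>) * ((Z *v (W *v Z $ n)) \<bullet> (D *v (W *v Z $ n)))\<bar> \<le> ?a * (d * ?a)"
    by (intro inner_scaled_le norm_Z_weight_le sqrt_norm_D_weight_le)
  thus ?thesis using a by (simp add: abs_mult pos_divide_le_eq mult_ac)
qed (simp add: posdef_weight)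

text \<open>Each of the three terms of the perturbation contributes at most d |x| |y|; for the
  quadratic one this uses d <= 1.\<close>

lemma abs_gram_pert_le:
  assumes d: "d \<le> 1/4"
  shows "\<bar>gram_pert \<gamma> Z D (W *v x) (W *v y)\<bar> \<le> 3 * d * wnorm W x * wnorm W y"
proof -
  have "\<bar>(1 - \<gamma>) * ((Z *v (W *v x)) \<bullet> (D *v (W *v y)))\<bar> \<le> wnorm W x * (d * wnorm W y)"
    by (intro inner_scaled_le norm_Z_weight_le sqrt_norm_D_weight_le)
  moreover have "\<bar>(1 - \<gamma>) * ((D *v (W *v x)) \<bullet> (Z *v (W *v y)))\<bar> \<le> (d * wnorm W x) * wnorm W y"
    by (intro inner_scaled_le norm_Z_weight_le sqrt_norm_D_weight_le)
  moreover have "\<bar>(1 - \<gamma>) * ((D *v (W *v x)) \<bullet> (D *v (W *v y)))\<bar> \<le> (d * wnorm W x) * (d * wnorm W y)"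
    by (intro inner_scaled_le sqrt_norm_D_weight_le)
  moreover have "(d * wnorm W x) * (d * wnorm W y) \<le> (d * wnorm W x) * (1 * wnorm W y)"
    using d weighted_size_nonneg wnorm_nonneg[OF posdef_weight] by (intro mult_left_mono mult_right_mono mult_nonneg_nonneg) auto
  ultimately show ?thesis
    unfolding gram_pert_def distrib_left by (simp add: mult_ac)
qed

text \<open>The perturbation takes away at most 3 d <= 3/4 of the Gram form, so a quarter remains;
  this is the origin of the threshold 1/4.\<close>

lemma gram_perturbed_ge:
  assumes d: "d \<le> 1/4"
  shows "v \<bullet> (gram \<gamma> Z *v v) \<le> 4 * (v \<bullet> (gram \<gamma> (Z + D) *v v))"
proof -
  define x where "x = gram \<gamma> Z *v v"
  have v: "v = W *v x" by (simp add: x_def gram_weight_apply)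
  have "v \<bullet> (gram \<gamma> Z *v v) = (wnorm W x)\<^sup>2"
    unfolding v gram_weight_apply wnorm_sq[OF posdef_weight] by (rule inner_commute)
  moreover have "\<bar>gram_pert \<gamma> Z D v v\<bar> \<le> 3 * d * wnorm W x * wnorm W x"
    unfolding v by (rule abs_gram_pert_le[OF d])
  moreover have "3 * d * (wnorm W x)\<^sup>2 \<le> 3 * (1/4) * (wnorm W x)\<^sup>2"
    using d by (intro mult_right_mono) auto
  ultimately show ?thesis
    unfolding gram_form_add power2_eq_square by (simp add: mult.assoc)
qed

lemma invertible_gram_perturbed:
  assumes d: "d \<le> 1/4"
  shows "invertible (gram \<gamma> (Z + D))"
proof (intro posdef_invertible, unfold posdef_def, intro conjI allI impI transpose_gram)
  fix x :: "real^'k" assume "x \<noteq> 0"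
  hence "0 < x \<bullet> (gram \<gamma> Z *v x)" using posdef_gram[OF \<gamma> i] by (simp add: posdef_def)
  thus "0 < x \<bullet> (gram \<gamma> (Z + D) *v x)" using gram_perturbed_ge[OF d, of x] by linarith
qed

text \<open>
  With \<open>M' = gram \<gamma> (Z + D) = M + E\<close> and \<open>M' v = z\<close>, testing \<open>z = M' v\<close> against \<open>W y\<close> gives
  \<open>y W z = y v + e(y, x)\<close> where \<open>x = M v\<close>, which replaces the expansion of the inverse matrix \<open>M'\<inverse>\<close>.
\<close>

lemma weight_perturbed_expansion:
  assumes d: "d \<le> 1/4"
  shows "\<bar>wnorm (weight \<gamma> (Z + D)) z - wnorm W z
           + gram_pert \<gamma> Z D (W *v z) (W *v z) / wnorm W z / 2\<bar> \<le> 90 * d\<^sup>2 * wnorm W z"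
proof (cases "z = 0")
  case True
  thus ?thesis
    by (simp add: posdef_weight wnorm_def)
next
  case False
  define M' where "M' = gram \<gamma> (Z + D)"
  define W' where "W' = weight \<gamma> (Z + D)"
  define e where "e x y = gram_pert \<gamma> Z D (W *v x) (W *v y)" for x y
  have i': "invertible M'" unfolding M'_def by (rule invertible_gram_perturbed[OF d])
  have M': "posdef M'" using i' unfolding M'_def by (rule posdef_gram[OF \<gamma>])
  have W': "posdef W'" unfolding W'_def weight_def M'_def[symmetric] by (rule posdef_matrix_inv[OF M'])
  define q where "q = wnorm W' z"
  define a where "a = wnorm W z"
  define v where "v = W' *v z"
  \<comment> \<open>This writes v as W x; without perturbation x would equal z, and the argument
    measures x - z.\<close>
  define x where "x = gram \<gamma> Z *v v"
  have a: "0 < a" unfolding a_def by (rule wnorm_pos[OF posdef_weight False])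
  have q: "0 < q" unfolding q_def by (rule wnorm_pos[OF W' False])
  have v: "v = W *v x" by (simp add: x_def gram_weight_apply)
  have M'v: "M' *v v = z" unfolding v_def W'_def weight_def M'_def[symmetric] by (rule posdef_inv_apply[OF M'])
  have qsq: "q\<^sup>2 = z \<bullet> v" by (simp add: q_def wnorm_sq[OF W'] v_def)
  have eb: "\<bar>e s t\<bar> \<le> 3 * d * wnorm W s * wnorm W t" for s t
    unfolding e_def by (rule abs_gram_pert_le[OF d])
  have er: "e s (t - u) = e s t - e s u" for s t u
    by (simp add: e_def gram_pert_def matrix_vector_mult_diff_distrib inner_diff algebra_simps)
  have key: "y \<bullet> (W *v z) = y \<bullet> v + e y x" for y
  proof -
    have "y \<bullet> (W *v z) = (W *v y) \<bullet> z"
      by (simp add: wip_commute[OF posdef_weight, of y z] inner_commute)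
    also have "\<dots> = (W *v y) \<bullet> (gram \<gamma> Z *v v) + e y x"
      unfolding M'v[symmetric] M'_def gram_form_add by (simp add: e_def v)
    also have "(W *v y) \<bullet> (gram \<gamma> Z *v v) = y \<bullet> v"
      by (simp add: v gram_weight_apply wip_commute[OF posdef_weight, of y x] inner_commute)
    finally show ?thesis .
  qed
  \<comment> \<open>Rough bounds come first: the norm of x and q are controlled by a, so that all
    later errors are expressed through d and a.\<close>
  have "(wnorm W x)\<^sup>2 = v \<bullet> (gram \<gamma> Z *v v)"
    by (simp add: wnorm_sq[OF posdef_weight] v[symmetric]) (simp add: x_def inner_commute)
  also have "\<dots> \<le> 4 * (v \<bullet> z)"
    using gram_perturbed_ge[OF d, of v] unfolding M'_def[symmetric] M'v .
  also have "\<dots> = (2 * q)\<^sup>2" by (simp add: power_mult_distrib qsq inner_commute)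
  finally have xq: "wnorm W x \<le> 2 * q" by (rule power2_le_imp_le) (use q in auto)
  have "q * q \<le> a * wnorm W x"
    using wip_Cauchy_Schwarz[OF posdef_weight, of z x] qsq by (simp add: v[symmetric] a_def power2_eq_square)
  also have "\<dots> \<le> a * (2 * q)" using xq a by (intro mult_left_mono) auto
  finally have qa: "q \<le> 2 * a" using q by simp
  have xa: "wnorm W x \<le> 4 * a" using xq qa by linarith
  \<comment> \<open>Testing \<open>key\<close> with y = x - z turns the squared distance into -e(y,
    x).\<close>
  have "wnorm W (x - z) \<le> 3 * d * wnorm W x"
  proof (cases "x = z")
    case False
    let ?y = "x - z"
    have y: "0 < wnorm W ?y" using False by (intro wnorm_pos[OF posdef_weight]) simp
    have "wnorm W ?y * wnorm W ?y = ?y \<bullet> v - ?y \<bullet> (W *v z)"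
      by (simp add: wnorm_sq[OF posdef_weight] v matrix_vector_mult_diff_distrib inner_diff_right flip: power2_eq_square)
    also have "\<dots> = - e ?y x" using key[of ?y] by simp
    also have "\<dots> \<le> 3 * d * wnorm W ?y * wnorm W x" using eb[of ?y x] by linarith
    finally show ?thesis using y by (simp add: mult_ac)
  qed (use weighted_size_nonneg wnorm_nonneg[OF posdef_weight] in \<open>simp add: posdef_weight\<close>)
  also have "\<dots> \<le> 3 * d * (4 * a)" using xa weighted_size_nonneg by (intro mult_left_mono) auto
  finally have xz: "wnorm W (x - z) \<le> 12 * d * a" by simp
  \<comment> \<open>Replacing x by z in e(z, x) costs O(d^2), because e and x - z are each of order
    d.\<close>
  have "a\<^sup>2 = q\<^sup>2 + e z x" using key[of z] by (simp add: a_def wnorm_sq[OF posdef_weight] qsq)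
  hence "q\<^sup>2 - (a\<^sup>2 - e z z) = - e z (x - z)" by (simp add: er)
  hence "\<bar>q\<^sup>2 - (a\<^sup>2 - e z z)\<bar> \<le> 3 * d * a * wnorm W (x - z)"
    using eb[of z "x - z"] by (simp add: a_def)
  also have "\<dots> \<le> 3 * d * a * (12 * d * a)"
    using xz weighted_size_nonneg a by (intro mult_left_mono) auto
  finally have E: "\<bar>q\<^sup>2 - (a\<^sup>2 - e z z)\<bar> \<le> 36 * d\<^sup>2 * a\<^sup>2" by (simp add: power2_eq_square mult_ac)
  have ezz: "\<bar>e z z\<bar> \<le> 3 * d * a\<^sup>2" using eb[of z z] by (simp add: a_def power2_eq_square mult_ac)
  have "36 * d\<^sup>2 * a\<^sup>2 \<le> 9 * d * a\<^sup>2"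
    using mult_right_mono[OF d weighted_size_nonneg] by (intro mult_right_mono) (auto simp: power2_eq_square)
  hence "\<bar>q\<^sup>2 - a\<^sup>2\<bar> \<le> 12 * d * a\<^sup>2" using E ezz by linarith
  moreover have "\<bar>q - a\<bar> * a \<le> \<bar>q\<^sup>2 - a\<^sup>2\<bar>"
  proof -
    have "\<bar>q\<^sup>2 - a\<^sup>2\<bar> = \<bar>q - a\<bar> * (q + a)"
      using a q by (simp add: power2_eq_square square_diff_square_factored abs_mult)
    thus ?thesis using q by (simp add: mult_left_mono)
  qed
  ultimately have "\<bar>q - a\<bar> * a \<le> 12 * d * a * a" by (simp add: power2_eq_square mult_ac)
  hence "\<bar>q - a\<bar> \<le> 12 * d * a" using a by simp
  hence "(q - a)\<^sup>2 \<le> (12 * d * a)\<^sup>2" using power_mono[of "\<bar>q - a\<bar>" "12 * d * a" 2] by simp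
  \<comment> \<open>An exact identity in place of a Taylor expansion of the square root. Its two
    error parts are at most 36 d^2 a^2 and 144 d^2 a^2; dividing the sum by 2 a gives the constant
    90.\<close>
  moreover have "q - a + e z z / a / 2 = (q\<^sup>2 - (a\<^sup>2 - e z z) - (q - a)\<^sup>2) / (2 * a)"
    using a by (simp add: field_simps power2_eq_square)
  ultimately have "\<bar>q - a + e z z / a / 2\<bar> * (2 * a) \<le> 180 * d\<^sup>2 * a\<^sup>2"
    using E a abs_triangle_ineq4[of "q\<^sup>2 - (a\<^sup>2 - e z z)" "(q - a)\<^sup>2"]
    by (simp add: abs_div power_mult_distrib)
  hence "\<bar>q - a + e z z / a / 2\<bar> \<le> 90 * d\<^sup>2 * a" using a by (simp add: power2_eq_square mult_ac)
  thus ?thesis by (simp add: q_def a_def e_def W'_def)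
qed

lemma Psi_expansion:
  assumes d: "d \<le> 1/4" and B: "\<And>n. wnorm W (Z $ n) \<le> B"
  shows "\<bar>Psi \<gamma> (Z + D) - wnorm1 W (Z + D) - dPsi \<gamma> Z D\<bar> \<le> real CARD('n) * (91 * B + 28) * d\<^sup>2"
proof -
  define W' where "W' = weight \<gamma> (Z + D)"
  define e where "e x y = gram_pert \<gamma> Z D (W *v x) (W *v y)" for x y
  define t where "t n = (1 - \<gamma>) / wnorm W (Z $ n) * ((Z *v (W *v Z $ n)) \<bullet> (D *v (W *v Z $ n)))" for n
  have row: "\<bar>wnorm W' ((Z + D) $ n) - wnorm W ((Z + D) $ n) + t n\<bar> \<le> (91 * B + 28) * d\<^sup>2" for n
  proof -
    define z where "z = Z $ n"
    define z' where "z' = (Z + D) $ n"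
    have zz: "z' - z = D $ n" by (simp add: z_def z'_def)
    have Dn: "wnorm W (D $ n) \<le> d" unfolding d_def by (rule wnorm_row_le_wnorm2[OF posdef_weight])
    have "wnorm W z' \<le> B + 1/4"
      using wnorm_triangle[OF posdef_weight, of z "D $ n"] B[of n] Dn d by (simp add: z_def z'_def)
    hence "90 * d\<^sup>2 * wnorm W z' \<le> 90 * d\<^sup>2 * (B + 1/4)" by (intro mult_left_mono) auto
    hence 1: "\<bar>wnorm W' z' - wnorm W z' + e z' z' / wnorm W z' / 2\<bar> \<le> 90 * d\<^sup>2 * (B + 1/4)"
      using weight_perturbed_expansion[OF d, of z'] by (simp add: W'_def e_def)
    have "\<bar>e z' z' / wnorm W z' - e z z / wnorm W z\<bar> \<le> 3 * (3 * d) * wnorm W (z' - z)"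
      unfolding e_def
      by (rule quotient_form_lipschitz[OF posdef_weight _ _ _ abs_gram_pert_le[OF d]])
        (simp_all add: gram_pert_def matrix_vector_mult_diff_distrib matrix_vector_mult_scaleR inner_diff algebra_simps)
    also have "\<dots> \<le> 3 * (3 * d) * d"
      unfolding zz using Dn weighted_size_nonneg by (intro mult_left_mono) auto
    finally have 2: "\<bar>e z' z' / wnorm W z' - e z z / wnorm W z\<bar> \<le> 9 * d\<^sup>2" by (simp add: power2_eq_square)
    \<comment> \<open>The two cross terms of the form agree on the diagonal and yield
      \<open>t n\<close>; what is left is quadratic in D.\<close>
    have 3: "\<bar>e z z / wnorm W z / 2 - t n\<bar> \<le> d\<^sup>2 * B / 2"
    proof (cases "z = 0")
      case True
      hence "0 \<le> B" using B[of n] by (simp add: z_def posdef_weight)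
      thus ?thesis using True by (simp add: z_def[symmetric] t_def posdef_weight)
    next
      case False
      have a: "0 < wnorm W z" using False by (rule wnorm_pos[OF posdef_weight])
      have "e z z / wnorm W z / 2 - t n = (1 - \<gamma>) * ((D *v (W *v z)) \<bullet> (D *v (W *v z))) / (2 * wnorm W z)"
        using a by (simp add: e_def t_def z_def[symmetric] gram_pert_def inner_commute field_simps)
      moreover have "\<bar>(1 - \<gamma>) * ((D *v (W *v z)) \<bullet> (D *v (W *v z)))\<bar> \<le> (d * wnorm W z) * (d * wnorm W z)"
        by (intro inner_scaled_le sqrt_norm_D_weight_le)
      ultimately have "\<bar>e z z / wnorm W z / 2 - t n\<bar> \<le> (d * wnorm W z) * (d * wnorm W z) / (2 * wnorm W z)"
        using a by (simp only: abs_divide abs_of_pos[of "2 * wnorm W z"]) (intro divide_right_mono, auto)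
      also have "\<dots> = d\<^sup>2 * wnorm W z / 2" using a by (simp add: power2_eq_square)
      also have "\<dots> \<le> d\<^sup>2 * B / 2" using B[of n] by (simp add: z_def mult_left_mono)
      finally show ?thesis .
    qed
    have "0 \<le> B" using B[of n] wnorm_nonneg[OF posdef_weight, of "Z $ n"] by linarith
    hence "0 \<le> B * d\<^sup>2" by simp
    moreover have "90 * d\<^sup>2 * (B + 1/4) = 90 * (B * d\<^sup>2) + 90/4 * d\<^sup>2"
      "(91 * B + 28) * d\<^sup>2 = 91 * (B * d\<^sup>2) + 28 * d\<^sup>2" "d\<^sup>2 * B / 2 = B * d\<^sup>2 / 2"
      by (simp_all add: algebra_simps)
    \<comment> \<open>The collected coefficient is 90.5 B + 27, rounded up.\<close>
    ultimately have "90 * d\<^sup>2 * (B + 1/4) + 9 * d\<^sup>2 / 2 + d\<^sup>2 * B / 2 \<le> (91 * B + 28) * d\<^sup>2"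
      using zero_le_power2[of d] by simp
    moreover have "\<bar>x + w\<bar> \<le> p + q / 2 + r"
      if "\<bar>x + y / 2\<bar> \<le> p" "\<bar>y - v\<bar> \<le> q" "\<bar>v / 2 - w\<bar> \<le> r" for x y v w p q r :: real
      using that by linarith
    note this[OF 1 2 3]
    ultimately have "\<bar>wnorm W' z' - wnorm W z' + t n\<bar> \<le> (91 * B + 28) * d\<^sup>2" by (rule order.trans[rotated])
    thus ?thesis by (simp add: z'_def)
  qed
  have "Psi \<gamma> (Z + D) = wnorm1 W' (Z + D)"
    unfolding W'_def by (intro Psi_eq_wnorm1 \<gamma> invertible_gram_perturbed d)
  hence "Psi \<gamma> (Z + D) - wnorm1 W (Z + D) - dPsi \<gamma> Z D
      = (\<Sum>n\<in>UNIV. wnorm W' ((Z + D) $ n) - wnorm W ((Z + D) $ n) + t n)"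
    by (simp add: wnorm1_def dPsi_def t_def W_def[symmetric] sum.distrib sum_subtractf)
  also have "\<bar>\<dots>\<bar> \<le> (\<Sum>n\<in>(UNIV::'n set). (91 * B + 28) * d\<^sup>2)"
    by (intro order.trans[OF sum_abs] sum_mono row)
  finally show ?thesis by simp
qed

text \<open>With v = W z and a^2 = z . v, the number a^2 is an entry of Z v and is also at most |z|
  |v|. Weighting the two resulting bounds on a^4 by 1 - \<gamma> and \<gamma> recovers the Gram form
  of v, which is a^2 again. So a^2 <= |z|^2 + 1, however large W is.\<close>

lemma wnorm_row_le: "wnorm W (Z $ n) \<le> 1 + norm Z"
proof (cases "Z $ n = 0")
  case False
  let ?z = "Z $ n"
  let ?v = "W *v ?z"
  define a where "a = wnorm W ?z"
  have a: "0 < a" unfolding a_def by (rule wnorm_pos[OF posdef_weight False])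
  have asq: "a\<^sup>2 = ?z \<bullet> ?v" by (simp add: a_def wnorm_sq[OF posdef_weight])
  have "a\<^sup>2 = ?v \<bullet> (gram \<gamma> Z *v ?v)" by (simp add: asq gram_weight_apply inner_commute)
  hence split: "a\<^sup>2 = \<gamma> * (norm ?v)\<^sup>2 + (1 - \<gamma>) * (norm (Z *v ?v))\<^sup>2"
    by (simp add: gram_form power2_norm_eq_inner)
  have "a\<^sup>2 \<le> norm ?z * norm ?v" unfolding asq by (rule norm_cauchy_schwarz)
  hence "(a\<^sup>2)\<^sup>2 \<le> (norm ?z * norm ?v)\<^sup>2" by (intro power_mono) auto
  hence 1: "\<gamma> * (a\<^sup>2)\<^sup>2 \<le> (norm ?z)\<^sup>2 * (\<gamma> * (norm ?v)\<^sup>2)"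
    using \<gamma>(1) mult_left_mono[of _ _ \<gamma>] by (fastforce simp: power_mult_distrib mult_ac)
  have "\<bar>a\<^sup>2\<bar> \<le> norm (Z *v ?v)"
    unfolding asq using component_le_norm_cart[of "Z *v ?v" n] by (simp add: matrix_vector_mul_component)
  hence "(a\<^sup>2)\<^sup>2 \<le> (norm (Z *v ?v))\<^sup>2" by (intro power_mono) auto
  hence 2: "(1 - \<gamma>) * (a\<^sup>2)\<^sup>2 \<le> (1 - \<gamma>) * (norm (Z *v ?v))\<^sup>2" using \<gamma> by (intro mult_left_mono) auto
  have "\<gamma> * (norm ?v)\<^sup>2 \<le> a\<^sup>2" "(1 - \<gamma>) * (norm (Z *v ?v))\<^sup>2 \<le> a\<^sup>2" using split \<gamma> by auto
  moreover from this(1) have "(norm ?z)\<^sup>2 * (\<gamma> * (norm ?v)\<^sup>2) \<le> (norm ?z)\<^sup>2 * a\<^sup>2"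
    by (rule mult_left_mono) simp
  ultimately have "\<gamma> * (a\<^sup>2)\<^sup>2 + (1 - \<gamma>) * (a\<^sup>2)\<^sup>2 \<le> (norm ?z)\<^sup>2 * a\<^sup>2 + a\<^sup>2"
    using 1 2 by linarith
  hence "a\<^sup>2 * a\<^sup>2 \<le> ((norm ?z)\<^sup>2 + 1) * a\<^sup>2" by (simp add: algebra_simps power2_eq_square[of "a\<^sup>2"])
  hence "a\<^sup>2 \<le> (norm ?z)\<^sup>2 + 1" using a by (subst (asm) mult_le_cancel_right) simp
  also have "\<dots> \<le> (1 + norm ?z)\<^sup>2" by (simp add: power2_eq_square algebra_simps)
  finally have "a \<le> 1 + norm ?z" by (rule power2_le_imp_le) simp
  thus ?thesis using Finite_Cartesian_Product.norm_nth_le[of Z n] by (simp add: a_def)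
qed (simp add: posdef_weight)

text \<open>As W inverts the Gram matrix, |x|^2 is the weighted product of x and
  \<open>gram \<gamma> Z *v x\<close>, and the weighted norm of the latter is at most (1 + |Z|) |x|.
  So W cannot be small while Z is bounded.\<close>

lemma norm_le_wnorm: "norm x \<le> (1 + norm Z) * wnorm W x"
proof -
  let ?y = "gram \<gamma> Z *v x"
  have "(wnorm W ?y)\<^sup>2 = x \<bullet> ?y" by (simp add: wnorm_sq[OF posdef_weight] gram_weight_apply inner_commute)
  also have "\<dots> = \<gamma> * (norm x)\<^sup>2 + (1 - \<gamma>) * (norm (Z *v x))\<^sup>2"
    by (simp add: gram_form power2_norm_eq_inner)
  also have "\<dots> \<le> 1 * (norm x)\<^sup>2 + 1 * (norm Z * norm x)\<^sup>2"
    using \<gamma> by (intro add_mono mult_mono power_mono norm_matrix_vector_le) auto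
  also have "\<dots> \<le> ((1 + norm Z) * norm x)\<^sup>2"
    by (simp add: power_mult_distrib power2_eq_square algebra_simps)
  finally have y: "wnorm W ?y \<le> (1 + norm Z) * norm x" by (rule power2_le_imp_le) simp
  have "norm x * norm x = x \<bullet> (W *v ?y)"
    by (simp add: gram_weight_apply power2_norm_eq_inner flip: power2_eq_square)
  also have "\<dots> \<le> wnorm W x * wnorm W ?y" using wip_Cauchy_Schwarz[OF posdef_weight, of x ?y] by linarith
  also have "\<dots> \<le> wnorm W x * ((1 + norm Z) * norm x)" using y wnorm_nonneg[OF posdef_weight] by (intro mult_left_mono)
  finally show ?thesis by (cases "x = 0") (auto simp: posdef_weight mult_ac)
qed

lemma norm_le_wnorm2: "norm D \<le> (1 + norm Z) * d"
proof -
  have "norm D \<le> L2_set (\<lambda>n. (1 + norm Z) * wnorm W (D $ n)) UNIV"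
    unfolding norm_vec_def[of D] by (intro L2_set_mono norm_le_wnorm) auto
  thus ?thesis by (simp add: d_def wnorm2_eq_L2_set[OF posdef_weight] L2_set_right_distrib)
qed

end

subsection \<open>The local model and the line search\<close>

definition dmodel ::
  "real \<Rightarrow> real \<Rightarrow> real^'n^'m \<Rightarrow> real^'k^'m \<Rightarrow> real^'k^'n \<Rightarrow> real^'k^'n \<Rightarrow> real" where
  "dmodel \<gamma> \<alpha> A Y Z X = dPsi \<gamma> Z X + 1 / \<alpha> * ((transpose A ** (A ** Z - Y)) \<bullet> X)"

text \<open>The inverse weight in \<open>grad\<close> cancels the weight in \<open>wprod\<close>,
  which leaves the Frobenius gradient.\<close>

lemma wprod_grad:
  assumes W: "posdef (weight \<gamma> Z)"
  shows "wprod (weight \<gamma> Z) (grad \<gamma> \<alpha> A Y Z) X = dmodel \<gamma> \<alpha> A Y Z X"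
proof -
  have "grad \<gamma> \<alpha> A Y Z ** weight \<gamma> Z = Z ** Lam \<gamma> Z + (1 / \<alpha>) *\<^sub>R (transpose A ** (A ** Z - Y))"
    by (simp add: grad_def matrix_inv_left[OF posdef_invertible[OF W]] flip: matrix_mul_assoc)
  thus ?thesis
    by (simp add: wprod_eq_inner dmodel_def inner_add_left inner_Lam_eq_dPsi[OF W])
qed

lemma inner_transpose_matrix_mult: "(transpose A ** B) \<bullet> D = B \<bullet> (A ** D)"
  for A :: "real^'n^'m"
proof -
  have "(transpose A ** B) \<bullet> D = (\<Sum>n\<in>UNIV. \<Sum>k\<in>UNIV. \<Sum>m\<in>UNIV. A $ m $ n * B $ m $ k * D $ n $ k)"
    by (simp add: inner_vec_def matrix_matrix_mult_def transpose_def sum_distrib_right)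
  also have "\<dots> = (\<Sum>n\<in>UNIV. \<Sum>m\<in>UNIV. \<Sum>k\<in>UNIV. A $ m $ n * B $ m $ k * D $ n $ k)"
    by (intro sum.cong refl sum.swap)
  also have "\<dots> = (\<Sum>m\<in>UNIV. \<Sum>n\<in>UNIV. \<Sum>k\<in>UNIV. A $ m $ n * B $ m $ k * D $ n $ k)"
    by (rule sum.swap)
  also have "\<dots> = (\<Sum>m\<in>UNIV. \<Sum>k\<in>UNIV. \<Sum>n\<in>UNIV. A $ m $ n * B $ m $ k * D $ n $ k)"
    by (intro sum.cong refl sum.swap)
  also have "\<dots> = B \<bullet> (A ** D)"
    by (simp add: inner_vec_def matrix_matrix_mult_def sum_distrib_left mult_ac)
  finally show ?thesis .
qed

lemma linear_matrix_mult_right: "linear (\<lambda>X :: real^'k^'n. A ** X)" for A :: "real^'n^'m"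
  by (rule linearI) (simp_all add: matrix_add_ldistrib matrix_scalar_ac flip: scalar_matrix_assoc)

text \<open>The data term is exactly quadratic, and its remainder is controlled by |D| <= (1 + |Z|)
  d. The constant depends on Z only through C, as one step-size threshold must serve all
  iterates.\<close>

lemma objective_expansion:
  fixes A :: "real^'n^'m" and Y :: "real^'k^'m"
  assumes \<gamma>: "0 \<le> \<gamma>" "\<gamma> \<le> 1" and \<alpha>: "0 < \<alpha>"
  obtains K where "0 \<le> K"
    "\<And>Z D :: real^'k^'n. norm Z \<le> C \<Longrightarrow> invertible (gram \<gamma> Z) \<Longrightarrow> wnorm2 (weight \<gamma> Z) D \<le> 1/4 \<Longrightarrow>
       \<bar>objective \<gamma> \<alpha> A Y (Z + D) - objective \<gamma> \<alpha> A Y Z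
         - (wnorm1 (weight \<gamma> Z) (Z + D) - wnorm1 (weight \<gamma> Z) Z + dmodel \<gamma> \<alpha> A Y Z D)\<bar>
       \<le> K * (wnorm2 (weight \<gamma> Z) D)\<^sup>2"
proof -
  obtain KA where KA: "0 < KA" "\<And>X :: real^'k^'n. norm (A ** X) \<le> KA * norm X"
    using linear_bounded_pos[OF linear_matrix_mult_right] by blast
  \<comment> \<open>Taking \<open>\<bar>C\<bar>\<close> keeps the constant nonnegative for every
    real C.\<close>
  define K where "K = real CARD('n) * (91 * (1 + \<bar>C\<bar>) + 28) + (KA * (1 + \<bar>C\<bar>))\<^sup>2 / (2 * \<alpha>)"
  show ?thesis
  proof (rule that)
    show "0 \<le> K" using \<alpha> by (simp add: K_def)
    fix Z D :: "real^'k^'n"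
    assume C: "norm Z \<le> C" and i: "invertible (gram \<gamma> Z)" and d: "wnorm2 (weight \<gamma> Z) D \<le> 1/4"
    define dd where "dd = wnorm2 (weight \<gamma> Z) D"
    note W = posdef_weight[OF \<gamma> i]
    have B: "wnorm (weight \<gamma> Z) (Z $ n) \<le> 1 + \<bar>C\<bar>" for n
      using wnorm_row_le[OF \<gamma> i, of n] C by linarith
    have 1: "\<bar>Psi \<gamma> (Z + D) - wnorm1 (weight \<gamma> Z) (Z + D) - dPsi \<gamma> Z D\<bar>
        \<le> real CARD('n) * (91 * (1 + \<bar>C\<bar>) + 28) * dd\<^sup>2"
      using Psi_expansion[OF \<gamma> i d B] by (simp add: dd_def)
    have "norm D \<le> (1 + norm Z) * dd" unfolding dd_def by (rule norm_le_wnorm2[OF \<gamma> i])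
    also have "\<dots> \<le> (1 + \<bar>C\<bar>) * dd"
      using C wnorm2_nonneg[OF W, of D] by (intro mult_right_mono) (auto simp: dd_def)
    finally have "norm (A ** D) \<le> KA * ((1 + \<bar>C\<bar>) * dd)"
      using KA by (meson mult_left_mono order.trans less_imp_le)
    hence "(norm (A ** D))\<^sup>2 \<le> (KA * (1 + \<bar>C\<bar>) * dd)\<^sup>2"
      by (intro power_mono) (simp_all add: mult.assoc)
    hence 2: "1 / (2 * \<alpha>) * (norm (A ** D))\<^sup>2 \<le> (KA * (1 + \<bar>C\<bar>))\<^sup>2 / (2 * \<alpha>) * dd\<^sup>2"
      using \<alpha> by (simp add: power_mult_distrib divide_right_mono)
    have "A ** (Z + D) - Y = (A ** Z - Y) + A ** D" by (simp add: matrix_add_ldistrib)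
    hence "(norm (A ** (Z + D) - Y))\<^sup>2
        = (norm (A ** Z - Y))\<^sup>2 + 2 * ((transpose A ** (A ** Z - Y)) \<bullet> D) + (norm (A ** D))\<^sup>2"
      by (simp only: inner_transpose_matrix_mult power2_norm_eq_inner)
        (simp add: inner_add inner_commute)
    hence "1 / (2 * \<alpha>) * (norm (A ** (Z + D) - Y))\<^sup>2 = 1 / (2 * \<alpha>) * (norm (A ** Z - Y))\<^sup>2
        + 1 / \<alpha> * ((transpose A ** (A ** Z - Y)) \<bullet> D) + 1 / (2 * \<alpha>) * (norm (A ** D))\<^sup>2"
      using \<alpha> by (simp add: add_divide_distrib)
    hence eq: "objective \<gamma> \<alpha> A Y (Z + D) - objective \<gamma> \<alpha> A Y Z
         - (wnorm1 (weight \<gamma> Z) (Z + D) - wnorm1 (weight \<gamma> Z) Z + dmodel \<gamma> \<alpha> A Y Z D)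
        = (Psi \<gamma> (Z + D) - wnorm1 (weight \<gamma> Z) (Z + D) - dPsi \<gamma> Z D) + 1 / (2 * \<alpha>) * (norm (A ** D))\<^sup>2"
      by (simp add: objective_def dmodel_def Psi_eq_wnorm1[OF \<gamma> i])
    have "0 \<le> 1 / (2 * \<alpha>) * (norm (A ** D))\<^sup>2" using \<alpha> by simp
    hence "\<bar>(Psi \<gamma> (Z + D) - wnorm1 (weight \<gamma> Z) (Z + D) - dPsi \<gamma> Z D) + 1 / (2 * \<alpha>) * (norm (A ** D))\<^sup>2\<bar>
        \<le> real CARD('n) * (91 * (1 + \<bar>C\<bar>) + 28) * dd\<^sup>2 + (KA * (1 + \<bar>C\<bar>))\<^sup>2 / (2 * \<alpha>) * dd\<^sup>2"
      using 1 2 by (intro order.trans[OF abs_triangle_ineq] add_mono) simp_all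
    thus "\<bar>objective \<gamma> \<alpha> A Y (Z + D) - objective \<gamma> \<alpha> A Y Z
         - (wnorm1 (weight \<gamma> Z) (Z + D) - wnorm1 (weight \<gamma> Z) Z + dmodel \<gamma> \<alpha> A Y Z D)\<bar>
       \<le> K * (wnorm2 (weight \<gamma> Z) D)\<^sup>2"
      unfolding eq K_def distrib_right dd_def .
  qed
qed

text \<open>The row terms decay with d, and the data term is handled by Cauchy-Schwarz. The bound
  later limits the length of a proximal step to a multiple of the step size.\<close>

lemma dmodel_bound:
  fixes A :: "real^'n^'m" and Y :: "real^'k^'m"
  assumes \<gamma>: "0 \<le> \<gamma>" "\<gamma> \<le> 1" and \<alpha>: "0 < \<alpha>"
  obtains L where "0 \<le> L"
    "\<And>Z D :: real^'k^'n. norm Z \<le> C \<Longrightarrow> invertible (gram \<gamma> Z) \<Longrightarrow>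
       \<bar>dmodel \<gamma> \<alpha> A Y Z D\<bar> \<le> L * wnorm2 (weight \<gamma> Z) D"
proof -
  obtain KA where KA: "0 < KA" "\<And>X :: real^'k^'n. norm (A ** X) \<le> KA * norm X"
    using linear_bounded_pos[OF linear_matrix_mult_right] by blast
  define c where "c = (KA * \<bar>C\<bar> + norm Y) * (KA * (1 + \<bar>C\<bar>))"
  define L where "L = real CARD('n) * (1 + \<bar>C\<bar>) + 1 / \<alpha> * c"
  show ?thesis
  proof (rule that)
    show "0 \<le> L" using \<alpha> KA(1) by (simp add: L_def c_def)
    fix Z D :: "real^'k^'n"
    assume C: "norm Z \<le> C" and i: "invertible (gram \<gamma> Z)"
    define d where "d = wnorm2 (weight \<gamma> Z) D"
    note W = posdef_weight[OF \<gamma> i]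
    have d: "0 \<le> d" unfolding d_def by (rule wnorm2_nonneg[OF W])
    let ?t = "\<lambda>n. (1 - \<gamma>) / wnorm (weight \<gamma> Z) (Z $ n) * ((Z *v (weight \<gamma> Z *v Z $ n)) \<bullet> (D *v (weight \<gamma> Z *v Z $ n)))"
    have "\<bar>?t n\<bar> \<le> (1 + \<bar>C\<bar>) * d" for n
    proof -
      have "\<bar>?t n\<bar> \<le> d * wnorm (weight \<gamma> Z) (Z $ n)" unfolding d_def by (rule abs_dPsi_term_le[OF \<gamma> i])
      also have "\<dots> \<le> d * (1 + \<bar>C\<bar>)"
        using wnorm_row_le[OF \<gamma> i, of n] C d by (intro mult_left_mono) auto
      finally show ?thesis by (simp add: mult.commute)
    qed
    hence "(\<Sum>n\<in>UNIV. \<bar>?t n\<bar>) \<le> real CARD('n) * ((1 + \<bar>C\<bar>) * d)"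
      using sum_bounded_above[of UNIV "\<lambda>n. \<bar>?t n\<bar>" "(1 + \<bar>C\<bar>) * d"] by simp
    hence 1: "\<bar>dPsi \<gamma> Z D\<bar> \<le> real CARD('n) * (1 + \<bar>C\<bar>) * d"
      unfolding dPsi_def using sum_abs[of ?t UNIV] by (simp add: mult.assoc)
    have "norm D \<le> (1 + norm Z) * d" unfolding d_def by (rule norm_le_wnorm2[OF \<gamma> i])
    also have "\<dots> \<le> (1 + \<bar>C\<bar>) * d"
      using C d by (intro mult_right_mono) auto
    finally have AD: "norm (A ** D) \<le> KA * ((1 + \<bar>C\<bar>) * d)"
      using KA by (meson mult_left_mono order.trans less_imp_le)
    have "norm (A ** Z - Y) \<le> norm (A ** Z) + norm Y" by (rule norm_triangle_ineq4)
    also have "norm (A ** Z) \<le> KA * \<bar>C\<bar>"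
      using KA(1) C by (intro order.trans[OF KA(2)] mult_left_mono) auto
    finally have AZ: "norm (A ** Z - Y) \<le> KA * \<bar>C\<bar> + norm Y" by simp
    have "\<bar>(transpose A ** (A ** Z - Y)) \<bullet> D\<bar> \<le> norm (A ** Z - Y) * norm (A ** D)"
      unfolding inner_transpose_matrix_mult by (rule Cauchy_Schwarz_ineq2)
    also have "\<dots> \<le> (KA * \<bar>C\<bar> + norm Y) * (KA * ((1 + \<bar>C\<bar>) * d))"
      using KA(1) by (intro mult_mono AZ AD) auto
    also have "\<dots> = c * d" by (simp add: c_def)
    finally have "\<bar>1 / \<alpha> * ((transpose A ** (A ** Z - Y)) \<bullet> D)\<bar> \<le> 1 / \<alpha> * (c * d)"
      unfolding abs_mult using \<alpha> by (simp add: divide_right_mono)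
    hence "\<bar>dmodel \<gamma> \<alpha> A Y Z D\<bar> \<le> real CARD('n) * (1 + \<bar>C\<bar>) * d + 1 / \<alpha> * (c * d)"
      using 1 unfolding dmodel_def by (intro order.trans[OF abs_triangle_ineq] add_mono)
    thus "\<bar>dmodel \<gamma> \<alpha> A Y Z D\<bar> \<le> L * wnorm2 (weight \<gamma> Z) D"
      unfolding d_def[symmetric] L_def distrib_right by (simp add: mult.assoc)
  qed
qed

text \<open>An instance of \<open>prox_variational\<close> at the shifted point; X = Z gives
  descent, arbitrary X gives the limiting inequality.\<close>

lemma candidate_variational:
  fixes Z X :: "real^'k^'n" and A :: "real^'n^'m" and Y :: "real^'k^'m" and \<alpha> :: real
  assumes W: "posdef (weight \<gamma> Z)" and s: "0 < s"
  defines "Zp \<equiv> candidate \<gamma> \<alpha> A Y s Z"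
  shows "wprod (weight \<gamma> Z) (Z - Zp) (X - Zp) - s * dmodel \<gamma> \<alpha> A Y Z (X - Zp)
    \<le> s * (wnorm1 (weight \<gamma> Z) X - wnorm1 (weight \<gamma> Z) Zp)"
proof -
  have "wprod (weight \<gamma> Z) (Z - s *\<^sub>R grad \<gamma> \<alpha> A Y Z - Zp) (X - Zp)
      \<le> s * (wnorm1 (weight \<gamma> Z) X - wnorm1 (weight \<gamma> Z) Zp)"
    unfolding Zp_def candidate_def by (rule prox_variational[OF W s])
  thus ?thesis
    by (simp add: wprod_diff_left wprod_scaleR_left wprod_grad[OF W])
qed

lemma predicted_eq:
  fixes Z :: "real^'k^'n" and A :: "real^'n^'m" and Y :: "real^'k^'m" and \<alpha> s :: real
  assumes W: "posdef (weight \<gamma> Z)"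
  defines "Zp \<equiv> candidate \<gamma> \<alpha> A Y s Z"
  shows "predicted \<gamma> \<alpha> A Y s Z = wnorm1 (weight \<gamma> Z) Zp - wnorm1 (weight \<gamma> Z) Z + dmodel \<gamma> \<alpha> A Y Z (Zp - Z)"
  by (simp add: predicted_def Let_def wprod_grad[OF W] Zp_def)

lemma dmodel_minus: "dmodel \<gamma> \<alpha> A Y Z (- X) = - dmodel \<gamma> \<alpha> A Y Z X"
  by (simp add: dmodel_def dPsi_def uminus_matrix_vector_mult sum_negf)

text \<open>For X = Z the variational inequality contains the squared step length, and its remaining
  terms combine to the predicted decrease.\<close>

lemma predicted_descent:
  assumes W: "posdef (weight \<gamma> Z)" and s: "0 < s"
  shows "(wnorm2 (weight \<gamma> Z) (candidate \<gamma> \<alpha> A Y s Z - Z))\<^sup>2 \<le> - (s * predicted \<gamma> \<alpha> A Y s Z)"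
proof -
  let ?Zp = "candidate \<gamma> \<alpha> A Y s Z" and ?W = "weight \<gamma> Z"
  have "(wnorm2 ?W (?Zp - Z))\<^sup>2 = wprod ?W (Z - ?Zp) (Z - ?Zp)"
    by (simp add: wprod_diff_left wprod_diff_right flip: wprod_self[OF W])
  thus ?thesis
    using candidate_variational[OF W s, of \<alpha> A Y Z] dmodel_minus[of \<gamma> \<alpha> A Y Z "?Zp - Z"]
    unfolding predicted_eq[OF W] by (simp add: algebra_simps)
qed

lemma predicted_nonpos:
  assumes "posdef (weight \<gamma> Z)" "0 < s"
  shows "predicted \<gamma> \<alpha> A Y s Z \<le> 0"
  using predicted_descent[OF assms, of \<alpha> A Y] assms(2)
  by (smt (verit) mult_pos_pos zero_le_power2)

text \<open>The change of J is at most p + K d^2 with d^2 <= -s p, so the error is absorbed by the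
  share (1 - \<kappa>) of -p once s K <= 1 - \<kappa>.\<close>

lemma small_steps_acceptable:
  fixes A :: "real^'n^'m" and Y :: "real^'k^'m"
  assumes \<gamma>: "0 \<le> \<gamma>" "\<gamma> \<le> 1" and \<alpha>: "0 < \<alpha>" and \<kappa>: "\<kappa> < 1"
  obtains s0 where "0 < s0"
    "\<And>Z :: real^'k^'n. \<And>s. norm Z \<le> C \<Longrightarrow> invertible (gram \<gamma> Z) \<Longrightarrow> 0 < s \<Longrightarrow> s \<le> s0 \<Longrightarrow>
       acceptable \<gamma> \<alpha> A Y \<kappa> Z s"
proof -
  obtain K where K: "0 \<le> K"
    "\<And>Z D :: real^'k^'n. norm Z \<le> C \<Longrightarrow> invertible (gram \<gamma> Z) \<Longrightarrow> wnorm2 (weight \<gamma> Z) D \<le> 1/4 \<Longrightarrow>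
       \<bar>objective \<gamma> \<alpha> A Y (Z + D) - objective \<gamma> \<alpha> A Y Z
         - (wnorm1 (weight \<gamma> Z) (Z + D) - wnorm1 (weight \<gamma> Z) Z + dmodel \<gamma> \<alpha> A Y Z D)\<bar>
       \<le> K * (wnorm2 (weight \<gamma> Z) D)\<^sup>2"
    by (rule objective_expansion[OF \<gamma> \<alpha>]) (rule that)
  obtain L where L: "0 \<le> L"
    "\<And>Z D :: real^'k^'n. norm Z \<le> C \<Longrightarrow> invertible (gram \<gamma> Z) \<Longrightarrow>
       \<bar>dmodel \<gamma> \<alpha> A Y Z D\<bar> \<le> L * wnorm2 (weight \<gamma> Z) D"
    by (rule dmodel_bound[OF \<gamma> \<alpha>]) (rule that)
  \<comment> \<open>A slope bound, -p <= L' d: the row norms contribute the number of rows, the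
    linear part contributes \<open>L\<close>.\<close>
  define L' where "L' = real CARD('n) + L"
  have L': "0 < L'" using L(1) by (simp add: L'_def add_pos_nonneg)
  \<comment> \<open>The first entry forces d <= s L' <= 1/4, where the expansion is valid; the
    second gives s K <= 1 - \<kappa>, with K + 1 because K may be 0.\<close>
  define s0 where "s0 = min (1 / (4 * L')) ((1 - \<kappa>) / (K + 1))"
  show ?thesis
  proof (rule that)
    show "0 < s0" using L' K(1) \<kappa> by (simp add: s0_def)
    fix Z :: "real^'k^'n" and s :: real
    assume C: "norm Z \<le> C" and i: "invertible (gram \<gamma> Z)" and s: "0 < s" "s \<le> s0"
    note W = posdef_weight[OF \<gamma> i]
    define Zp where "Zp = candidate \<gamma> \<alpha> A Y s Z"
    define D where "D = Zp - Z"
    define d where "d = wnorm2 (weight \<gamma> Z) D"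
    define p where "p = predicted \<gamma> \<alpha> A Y s Z"
    have d0: "0 \<le> d" unfolding d_def by (rule wnorm2_nonneg[OF W])
    have dp: "d\<^sup>2 \<le> - (s * p)"
      unfolding d_def D_def Zp_def p_def by (rule predicted_descent[OF W s(1)])
    have Zp: "Zp = Z + D" by (simp add: D_def)
    have p: "p = wnorm1 (weight \<gamma> Z) (Z + D) - wnorm1 (weight \<gamma> Z) Z + dmodel \<gamma> \<alpha> A Y Z D"
      unfolding p_def predicted_eq[OF W] Zp_def[symmetric] D_def by simp
    have "wnorm1 (weight \<gamma> Z) Z - wnorm1 (weight \<gamma> Z) (Z + D) \<le> wnorm1 (weight \<gamma> Z) D"
      unfolding wnorm1_def sum_subtractf[symmetric]
    proof (intro sum_mono)
      fix n
      show "wnorm (weight \<gamma> Z) (Z $ n) - wnorm (weight \<gamma> Z) ((Z + D) $ n) \<le> wnorm (weight \<gamma> Z) (D $ n)"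
        using wnorm_diff_ineq[OF W, of "(Z + D) $ n" "Z $ n"] by simp
    qed
    also have "\<dots> \<le> real CARD('n) * d" unfolding d_def by (rule wnorm1_le_wnorm2[OF W])
    finally have "- p \<le> L' * d"
      using L(2)[OF C i, of D] unfolding p by (simp add: L'_def d_def distrib_right)
    hence "s * (- p) \<le> s * (L' * d)" using s by (intro mult_left_mono) auto
    \<comment> \<open>This chains d^2 <= -s p with -p <= L' d; cancelling d shows that the step
      length is of order s.\<close>
    hence "d * d \<le> (s * L') * d" using dp by (simp add: power2_eq_square mult_ac)
    hence "d \<le> s * L'" using d0 s L' by (cases "d = 0") auto
    also have "\<dots> \<le> 1 / (4 * L') * L'" using s L' by (intro mult_right_mono) (auto simp: s0_def)
    finally have d: "d \<le> 1/4" using L' by simp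
    have "s \<le> (1 - \<kappa>) / (K + 1)" using s by (simp add: s0_def)
    hence sK: "s * (K + 1) \<le> 1 - \<kappa>" using K(1) by (simp add: pos_le_divide_eq)
    have p0: "p \<le> 0" unfolding p_def by (rule predicted_nonpos[OF W s(1)])
    have "objective \<gamma> \<alpha> A Y Zp - objective \<gamma> \<alpha> A Y Z \<le> p + K * d\<^sup>2"
      using K(2)[OF C i, of D] d unfolding d_def Zp p by linarith
    also have "K * d\<^sup>2 \<le> K * (- (s * p))" using dp K(1) by (intro mult_left_mono)
    also have "\<dots> = (s * K) * (- p)" by simp
    also have "\<dots> \<le> (1 - \<kappa>) * (- p)" using sK s p0 by (intro mult_right_mono) (auto simp: distrib_left)
    finally have "objective \<gamma> \<alpha> A Y Zp - objective \<gamma> \<alpha> A Y Z \<le> \<kappa> * p" by (simp add: algebra_simps)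
    moreover have "invertible (gram \<gamma> Zp)"
      using invertible_gram_perturbed[OF \<gamma> i] d unfolding Zp d_def by blast
    ultimately show "acceptable \<gamma> \<alpha> A Y \<kappa> Z s"
      by (simp add: acceptable_def Zp_def p_def)
  qed
qed

lemma line_search_range:
  assumes ls: "line_search \<gamma> \<alpha> A Y \<kappa> \<beta> smax sprev Z s"
    and \<beta>: "0 < \<beta>" "\<beta> < 1" and pos: "0 < smax" "0 < sprev"
  shows "0 < s" "s \<le> smax"
proof -
  obtain j where j: "s = \<beta> ^ j * min smax (sprev / \<beta>)"
    using ls by (auto simp: line_search_def trial_steps_def Let_def)
  show "0 < s" using j \<beta> pos by simp
  have "s \<le> 1 * min smax (sprev / \<beta>)"
    unfolding j using \<beta> pos by (intro mult_right_mono power_le_one) auto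
  thus "s \<le> smax" by simp
qed

text \<open>Either the first trial is accepted, and it is at least \<open>min smax sprev\<close>
  since \<beta> < 1, or the preceding trial s / \<beta> was rejected and therefore exceeds
  s0.\<close>

lemma line_search_lower_bound:
  assumes ls: "line_search \<gamma> \<alpha> A Y \<kappa> \<beta> smax sprev Z s"
    and \<beta>: "0 < \<beta>" "\<beta> < 1" and pos: "0 < smax" "0 < sprev"
    and acc: "\<And>t. 0 < t \<Longrightarrow> t \<le> s0 \<Longrightarrow> acceptable \<gamma> \<alpha> A Y \<kappa> Z t"
  shows "min (min smax sprev) (\<beta> * s0) \<le> s"
proof -
  let ?m = "min smax (sprev / \<beta>)"
  have m: "0 < ?m" using \<beta> pos by simp
  have max: "t \<le> s" if "t \<in> trial_steps \<beta> smax sprev" "acceptable \<gamma> \<alpha> A Y \<kappa> Z t" for t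
    using ls that by (auto simp: line_search_def Let_def)
  have "s \<in> trial_steps \<beta> smax sprev" using ls by (auto simp: line_search_def Let_def)
  then obtain j where j: "s = \<beta> ^ j * ?m" unfolding trial_steps_def by (rule rangeE)
  show ?thesis
  proof (cases j)
    case 0
    have "sprev \<le> sprev / \<beta>" using \<beta> pos by (simp add: field_simps)
    thus ?thesis using j 0 by auto
  next
    case (Suc k)
    define t where "t = \<beta> ^ k * ?m"
    have t: "s = \<beta> * t" "0 < t" using j Suc m \<beta> by (simp_all add: t_def)
    have "t \<in> trial_steps \<beta> smax sprev" by (auto simp: t_def trial_steps_def)
    moreover have "s < t" using t \<beta> by simp
    ultimately have "\<not> acceptable \<gamma> \<alpha> A Y \<kappa> Z t" using max[of t] by linarith
    hence "s0 < t" using acc[of t] t(2) by linarith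
    hence "\<beta> * s0 \<le> s" using \<beta> t by simp
    thus ?thesis by auto
  qed
qed

subsection \<open>First-order conditions from the limiting variational inequality\<close>

text \<open>The limit superior dominates the quotients with base point Z itself, and these are at
  least -K v^2 t by the expansion and the variational inequality.\<close>

lemma clarke_stationary:
  fixes A :: "real^'n^'m" and Y :: "real^'k^'m" and Z :: "real^'k^'n"
  assumes \<gamma>: "0 \<le> \<gamma>" "\<gamma> \<le> 1" and \<alpha>: "0 < \<alpha>" and i: "invertible (gram \<gamma> Z)"
    and vi: "\<And>X. 0 \<le> wnorm1 (weight \<gamma> Z) X - wnorm1 (weight \<gamma> Z) Z + dmodel \<gamma> \<alpha> A Y Z (X - Z)"
  shows "0 \<in> clarke_subdiff (objective \<gamma> \<alpha> A Y) Z"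
  unfolding clarke_subdiff_def mem_Collect_eq
proof
  fix V :: "real^'k^'n"
  let ?J = "objective \<gamma> \<alpha> A Y"
  note W = posdef_weight[OF \<gamma> i]
  obtain K where K: "0 \<le> K"
    "\<And>Z' D :: real^'k^'n. norm Z' \<le> norm Z \<Longrightarrow> invertible (gram \<gamma> Z') \<Longrightarrow> wnorm2 (weight \<gamma> Z') D \<le> 1/4 \<Longrightarrow>
       \<bar>?J (Z' + D) - ?J Z'
         - (wnorm1 (weight \<gamma> Z') (Z' + D) - wnorm1 (weight \<gamma> Z') Z' + dmodel \<gamma> \<alpha> A Y Z' D)\<bar>
       \<le> K * (wnorm2 (weight \<gamma> Z') D)\<^sup>2"
    by (rule objective_expansion[OF \<gamma> \<alpha>]) (rule that)
  define v where "v = wnorm2 (weight \<gamma> Z) V"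
  have v: "0 \<le> v" unfolding v_def by (rule wnorm2_nonneg[OF W])
  have scale: "wnorm2 (weight \<gamma> Z) (t *\<^sub>R V) = t * v" if "0 \<le> t" for t
    unfolding v_def wnorm2_eq_L2_set[OF W] using that
    by (simp add: wnorm_scaleR[OF W] L2_set_right_distrib)
  \<comment> \<open>The restriction on t keeps t v <= 1/4; v + 1 avoids division by 0 when V =
    0.\<close>
  have low: "- (K * v\<^sup>2 * t) \<le> (?J (Z + t *\<^sub>R V) - ?J Z) / t" if t: "0 < t" "t < 1 / (4 * (v + 1))" for t
  proof -
    have "t * v \<le> t * (v + 1)" using t by simp
    also have "\<dots> \<le> 1/4" using t v by (simp add: field_simps)
    finally have "t * v \<le> 1/4" .
    hence "\<bar>?J (Z + t *\<^sub>R V) - ?J Z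
         - (wnorm1 (weight \<gamma> Z) (Z + t *\<^sub>R V) - wnorm1 (weight \<gamma> Z) Z + dmodel \<gamma> \<alpha> A Y Z (t *\<^sub>R V))\<bar>
       \<le> K * (t * v)\<^sup>2"
      using K(2)[OF order_refl i, of "t *\<^sub>R V"] t by (simp add: scale)
    moreover have "0 \<le> wnorm1 (weight \<gamma> Z) (Z + t *\<^sub>R V) - wnorm1 (weight \<gamma> Z) Z + dmodel \<gamma> \<alpha> A Y Z (t *\<^sub>R V)"
      using vi[of "Z + t *\<^sub>R V"] by simp
    ultimately have "- (K * (t * v)\<^sup>2) \<le> ?J (Z + t *\<^sub>R V) - ?J Z" by linarith
    thus ?thesis using t by (simp add: pos_le_divide_eq power2_eq_square mult_ac)
  qed
  have "0 \<le> clarke_dd ?J Z V"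
    unfolding clarke_dd_def
  proof (rule Limsup_greatest)
    fix P :: "(real^'k^'n) \<times> real \<Rightarrow> bool"
    assume "eventually P (nhds Z \<times>\<^sub>F at_right 0)"
    then obtain Pf Pg where P: "eventually Pf (nhds Z)" "eventually Pg (at_right (0::real))"
      "\<And>x y. Pf x \<Longrightarrow> Pg y \<Longrightarrow> P (x, y)"
      by (auto simp: eventually_prod_filter)
    let ?s = "SUP x\<in>Collect P. case x of (y, t) \<Rightarrow> ereal ((?J (y + t *\<^sub>R V) - ?J y) / t)"
    \<comment> \<open>A property holding near Z holds at Z, so the supremum includes the pairs (Z,
      t) with small t > 0.\<close>
    have PZ: "Pf Z" using P(1) by (rule eventually_nhds_x_imp_x)
    have "0 < 1 / (4 * (v + 1))" using v by simp
    hence "eventually (\<lambda>t. t \<in> {0<..<1 / (4 * (v + 1))}) (at_right (0::real))"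
      by (rule eventually_at_right_real)
    with P(2) have "eventually (\<lambda>t. ereal (- (K * v\<^sup>2 * t)) \<le> ?s) (at_right (0::real))"
    proof eventually_elim
      case (elim t)
      have "ereal (- (K * v\<^sup>2 * t)) \<le> ereal ((?J (Z + t *\<^sub>R V) - ?J Z) / t)"
        using low[of t] elim(2) by simp
      also have "\<dots> \<le> ?s" using P(3)[OF PZ elim(1)] by (intro SUP_upper2[of "(Z, t)"]) auto
      finally show ?case .
    qed
    moreover have "((\<lambda>t. ereal (- (K * v\<^sup>2 * t))) \<longlongrightarrow> ereal (- (K * v\<^sup>2 * 0))) (at_right 0)"
      by (intro tendsto_intros)
    ultimately have "ereal (- (K * v\<^sup>2 * 0)) \<le> ?s"
      by (intro tendsto_upperbound) auto
    thus "0 \<le> ?s" by (simp add: zero_ereal_def)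
  qed
  thus "ereal (0 \<bullet> V) \<le> clarke_dd ?J Z V" by (simp add: zero_ereal_def)
qed

text \<open>Perturbing row n alone collapses the variational inequality to one row norm plus a
  linear form. At a nonzero row the norm is differentiable, so the gradient vanishes; at a zero row
  the inequality bounds the dual norm of the linear form.\<close>

lemma row_conditions:
  fixes A :: "real^'n^'m" and Y :: "real^'k^'m" and Z :: "real^'k^'n"
  assumes \<gamma>: "0 \<le> \<gamma>" "\<gamma> \<le> 1" and \<alpha>: "0 < \<alpha>" and i: "invertible (gram \<gamma> Z)"
    and vi: "\<And>X. 0 \<le> wnorm1 (weight \<gamma> Z) X - wnorm1 (weight \<gamma> Z) Z + dmodel \<gamma> \<alpha> A Y Z (X - Z)"
  defines "W \<equiv> weight \<gamma> Z" and "D \<equiv> transpose A ** (A ** Z - Y)"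
  shows "Z $ n \<noteq> 0 \<Longrightarrow>
      Z $ n v* ((1 / wnorm W (Z $ n)) *\<^sub>R W
        - (\<Sum>i\<in>{i. Z $ i \<noteq> 0}. ((1 - \<gamma>) / wnorm W (Z $ i)) *\<^sub>R rank1 W (Z $ i)))
      + (1 / \<alpha>) *\<^sub>R (D $ n) = 0" (is "_ \<Longrightarrow> ?u = 0")
    and "Z $ n = 0 \<Longrightarrow> wnorm (matrix_inv W) (D $ n) \<le> \<alpha>"
proof -
  have W: "posdef W" unfolding W_def by (rule posdef_weight[OF \<gamma> i])
  define z where "z = Z $ n"
  define c where "c = z v* Lam \<gamma> Z + (1 / \<alpha>) *\<^sub>R (D $ n)"
  have key: "0 \<le> wnorm W (z + v) - wnorm W z + c \<bullet> v" for v
  proof -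
    define X where "X = Z + axis n v"
    have "wnorm1 W X - wnorm1 W Z = (\<Sum>m\<in>UNIV. wnorm W (X $ m) - wnorm W (Z $ m))"
      by (simp add: wnorm1_def sum_subtractf)
    also have "\<dots> = (\<Sum>m\<in>{n}. wnorm W (X $ m) - wnorm W (Z $ m))"
      by (intro sum.mono_neutral_right) (auto simp: X_def axis_def)
    also have "\<dots> = wnorm W (z + v) - wnorm W z" by (simp add: X_def z_def axis_def)
    finally have 1: "wnorm1 W X - wnorm1 W Z = wnorm W (z + v) - wnorm W z" .
    have "dmodel \<gamma> \<alpha> A Y Z (X - Z) = (Z ** Lam \<gamma> Z + (1 / \<alpha>) *\<^sub>R D) \<bullet> axis n v"
      by (simp add: dmodel_def inner_Lam_eq_dPsi[OF posdef_weight[OF \<gamma> i]] inner_add_left X_def D_def)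
    also have "\<dots> = c \<bullet> v"
      by (simp add: inner_axis' inner_axis c_def z_def matrix_mult_row)
    finally show ?thesis using vi[of X] 1 by (simp add: W_def)
  qed
  {
    assume nz: "Z $ n \<noteq> 0"
    define a where "a = wnorm W z"
    have a: "0 < a" unfolding a_def z_def by (rule wnorm_pos[OF W nz])
    define u where "u = (1 / a) *\<^sub>R (W *v z) + c"
    have uv: "0 \<le> u \<bullet> v" for v
    proof -
      have ineq: "0 \<le> u \<bullet> v + t * ((wnorm W v)\<^sup>2 / (2 * a))" if t: "0 < t" for t
      proof -
        define b where "b = wnorm W (z + t *\<^sub>R v)"
        \<comment> \<open>This bounds b - a by (b^2 - a^2) / (2 a), a polynomial in t, which
          replaces differentiating the norm.\<close>
        have "0 \<le> (b - a)\<^sup>2" by simp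
        hence "b * (2 * a) \<le> b\<^sup>2 + a\<^sup>2" by (simp add: power2_eq_square algebra_simps)
        moreover have "b\<^sup>2 = a\<^sup>2 + 2 * t * (v \<bullet> (W *v z)) + t\<^sup>2 * (wnorm W v)\<^sup>2"
          unfolding b_def a_def wnorm_sq[OF W]
          by (simp add: matrix_vector_right_distrib matrix_vector_mult_scaleR inner_add
              wip_commute[OF W, of z v] power2_eq_square algebra_simps)
        ultimately have "(b - a) * (2 * a) \<le> 2 * t * (v \<bullet> (W *v z)) + t\<^sup>2 * (wnorm W v)\<^sup>2"
          by (simp add: power2_eq_square algebra_simps)
        hence "b - a \<le> (2 * t * (v \<bullet> (W *v z)) + t\<^sup>2 * (wnorm W v)\<^sup>2) / (2 * a)"
          using a by (simp add: pos_le_divide_eq)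
        also have "\<dots> = t * (v \<bullet> (W *v z) / a + t * ((wnorm W v)\<^sup>2 / (2 * a)))"
          using a by (simp add: field_simps power2_eq_square)
        finally have "0 \<le> t * (v \<bullet> (W *v z) / a + t * ((wnorm W v)\<^sup>2 / (2 * a))) + t * (c \<bullet> v)"
          using key[of "t *\<^sub>R v"] by (simp add: a_def b_def)
        also have "\<dots> = t * (u \<bullet> v + t * ((wnorm W v)\<^sup>2 / (2 * a)))"
          by (simp add: u_def inner_add_left inner_commute algebra_simps)
        finally show ?thesis using t by (simp add: zero_le_mult_iff)
      qed
      have "((\<lambda>t. u \<bullet> v + t * ((wnorm W v)\<^sup>2 / (2 * a))) \<longlongrightarrow> u \<bullet> v + 0 * ((wnorm W v)\<^sup>2 / (2 * a))) (at_right (0::real))"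
        by (intro tendsto_intros)
      moreover have "eventually (\<lambda>t. 0 \<le> u \<bullet> v + t * ((wnorm W v)\<^sup>2 / (2 * a))) (at_right (0::real))"
        using eventually_at_right_less[of "0::real"] by eventually_elim (rule ineq)
      ultimately have "0 \<le> u \<bullet> v + 0 * ((wnorm W v)\<^sup>2 / (2 * a))"
        by (intro tendsto_lowerbound) auto
      thus ?thesis by simp
    qed
    have "u \<bullet> u \<le> 0" using uv[of "- u"] by simp
    hence "u = 0" by (metis inner_eq_zero_iff inner_ge_zero order_antisym)
    moreover have "?u = u"
    proof -
      have "z v* ((1 / a) *\<^sub>R W - S) = (1 / a) *\<^sub>R (z v* W) + z v* (- S)" for S :: "real^'k^'k"
        by (simp add: vec_eq_iff vector_matrix_mult_def sum.distrib sum_distrib_left sum_negf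
            sum_subtractf algebra_simps)
      thus ?thesis
        by (simp add: u_def c_def a_def z_def Lam_def Let_def W_def[symmetric]
            vector_matrix_mult_symmetric[OF posdef_symmetric[OF W]])
    qed
    ultimately show "?u = 0" by simp
  }
  {
    assume zero: "Z $ n = 0"
    define M where "M = matrix_inv W"
    define g where "g = D $ n"
    have M: "posdef M" unfolding M_def by (rule posdef_matrix_inv[OF W])
    have c: "c = (1 / \<alpha>) *\<^sub>R g" by (simp add: c_def z_def zero g_def)
    \<comment> \<open>The extremal direction of the dual pairing: its \<open>W\<close>-norm is
      |g|_M, while g . v = -|g|_M^2.\<close>
    define v where "v = - (M *v g)"
    have "(wnorm W v)\<^sup>2 = (M *v g) \<bullet> (W *v (M *v g))"
      using linear_neg[OF matrix_vector_mul_linear, of W] by (simp add: wnorm_sq[OF W] v_def)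
    also have "\<dots> = (wnorm M g)\<^sup>2"
      using posdef_inv_apply(1)[OF W, of g] by (simp add: wnorm_sq[OF M] inner_commute M_def[symmetric])
    finally have "(wnorm W v)\<^sup>2 = (wnorm M g)\<^sup>2" .
    hence Wv: "wnorm W v = wnorm M g"
      by (metis power2_eq_iff_nonneg wnorm_nonneg[OF W] wnorm_nonneg[OF M])
    have "0 \<le> wnorm W v + c \<bullet> v" using key[of v] by (simp add: z_def zero W)
    hence "(wnorm M g)\<^sup>2 \<le> \<alpha> * wnorm M g"
      using \<alpha> by (simp add: c v_def Wv[unfolded v_def] wnorm_sq[OF M] field_simps)
    hence "wnorm M g \<le> \<alpha>"
      using wnorm_nonneg[OF M, of g] \<alpha> by (cases "wnorm M g = 0") (auto simp: power2_eq_square)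
    thus "wnorm (matrix_inv W) (D $ n) \<le> \<alpha>" by (simp add: M_def g_def)
  }
qed

subsection \<open>Passing to the limit\<close>

lemma tendsto_matrix_vector_mult [tendsto_intros]:
  fixes M :: "'b \<Rightarrow> real^'k^'n"
  assumes "(M \<longlongrightarrow> M') F" "(x \<longlongrightarrow> x') F"
  shows "((\<lambda>k. M k *v x k) \<longlongrightarrow> M' *v x') F"
  unfolding matrix_vector_mult_def
  by (intro vec_tendstoI) (auto intro!: tendsto_intros assms)

lemma tendsto_vector_matrix_mult [tendsto_intros]:
  fixes M :: "'b \<Rightarrow> real^'k^'n"
  assumes "(M \<longlongrightarrow> M') F" "(x \<longlongrightarrow> x') F"
  shows "((\<lambda>k. x k v* M k) \<longlongrightarrow> x' v* M') F"
  unfolding vector_matrix_mult_def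
  by (intro vec_tendstoI) (auto intro!: tendsto_intros assms)

lemma tendsto_matrix_matrix_mult [tendsto_intros]:
  fixes M :: "'b \<Rightarrow> real^'k^'n" and N :: "'b \<Rightarrow> real^'l^'k"
  assumes "(M \<longlongrightarrow> M') F" "(N \<longlongrightarrow> N') F"
  shows "((\<lambda>k. M k ** N k) \<longlongrightarrow> M' ** N') F"
  unfolding matrix_matrix_mult_def
  by (intro vec_tendstoI) (auto intro!: tendsto_intros assms)

lemma tendsto_transpose [tendsto_intros]:
  fixes M :: "'b \<Rightarrow> real^'k^'n"
  assumes "(M \<longlongrightarrow> M') F"
  shows "((\<lambda>k. transpose (M k)) \<longlongrightarrow> transpose M') F"
  unfolding transpose_def
  by (intro vec_tendstoI) (auto intro!: tendsto_intros assms)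

lemma tendsto_det [tendsto_intros]:
  fixes M :: "'b \<Rightarrow> real^'k^'k"
  assumes "(M \<longlongrightarrow> M') F"
  shows "((\<lambda>k. det (M k)) \<longlongrightarrow> det M') F"
  unfolding det_def by (intro tendsto_intros assms)

text \<open>Entries as quotients of determinants make the continuity of inversion immediate.\<close>

lemma matrix_inv_cramer:
  fixes M :: "real^'k^'k"
  assumes "invertible M"
  shows "matrix_inv M $ p $ l = det (\<chi> i j. if j = p then axis l 1 $ i else M $ i $ j) / det M"
proof -
  have "M *v (matrix_inv M *v axis l 1) = axis l 1"
    by (simp add: matrix_vector_mul_assoc matrix_inv_right[OF assms])
  hence "matrix_inv M *v axis l 1
      = (\<chi> p. det (\<chi> i j. if j = p then axis l 1 $ i else M $ i $ j) / det M)"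
    using assms by (subst (asm) cramer) (simp_all add: invertible_det_nz)
  moreover have "(matrix_inv M *v axis l 1) $ p = matrix_inv M $ p $ l"
    by (simp add: matrix_vector_mul_component inner_axis)
  ultimately show ?thesis by simp
qed

lemma tendsto_matrix_inv:
  fixes M :: "'b \<Rightarrow> real^'k^'k"
  assumes lim: "(M \<longlongrightarrow> M') F" and i: "\<And>k. invertible (M k)" "invertible M'"
  shows "((\<lambda>k. matrix_inv (M k)) \<longlongrightarrow> matrix_inv M') F"
proof (intro vec_tendstoI)
  fix p l
  have "((\<lambda>k. \<chi> i j. if j = p then axis l 1 $ i else M k $ i $ j)
      \<longlongrightarrow> (\<chi> i j. if j = p then axis l 1 $ i else M' $ i $ j)) F"
    by (intro vec_tendstoI) (auto intro!: tendsto_intros lim)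
  thus "((\<lambda>k. matrix_inv (M k) $ p $ l) \<longlongrightarrow> matrix_inv M' $ p $ l) F"
    unfolding matrix_inv_cramer[OF i(1)] matrix_inv_cramer[OF i(2)]
    using i(2) by (intro tendsto_divide tendsto_det lim) (simp_all add: invertible_det_nz)
qed

lemma tendsto_wnorm [tendsto_intros]:
  fixes W :: "'b \<Rightarrow> real^'k^'k"
  assumes "(W \<longlongrightarrow> W') F" "(x \<longlongrightarrow> x') F"
  shows "((\<lambda>k. wnorm (W k) (x k)) \<longlongrightarrow> wnorm W' x') F"
  unfolding wnorm_def by (intro tendsto_intros assms)

lemma tendsto_wnorm1 [tendsto_intros]:
  fixes W :: "'b \<Rightarrow> real^'k^'k"
  assumes "(W \<longlongrightarrow> W') F" "(X \<longlongrightarrow> X') F"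
  shows "((\<lambda>k. wnorm1 (W k) (X k)) \<longlongrightarrow> wnorm1 W' X') F"
  unfolding wnorm1_def by (intro tendsto_intros assms)

lemma tendsto_wnorm2 [tendsto_intros]:
  fixes W :: "'b \<Rightarrow> real^'k^'k"
  assumes "(W \<longlongrightarrow> W') F" "(X \<longlongrightarrow> X') F"
  shows "((\<lambda>k. wnorm2 (W k) (X k)) \<longlongrightarrow> wnorm2 W' X') F"
  unfolding wnorm2_def by (intro tendsto_intros assms)

lemma tendsto_weight:
  fixes Z :: "'b \<Rightarrow> real^'k^'n"
  assumes "(Z \<longlongrightarrow> Z') F" "\<And>k. invertible (gram \<gamma> (Z k))" "invertible (gram \<gamma> Z')"
  shows "((\<lambda>k. weight \<gamma> (Z k)) \<longlongrightarrow> weight \<gamma> Z') F"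
proof -
  have "((\<lambda>k. gram \<gamma> (Z k)) \<longlongrightarrow> gram \<gamma> Z') F"
    unfolding gram_def by (intro tendsto_intros assms(1))
  thus ?thesis unfolding weight_def using assms(2,3) by (rule tendsto_matrix_inv)
qed

text \<open>At a row that vanishes in the limit the limit laws fail for the quotient, and
  \<open>abs_dPsi_term_le\<close> squeezes the whole term to 0; at other rows they apply
  directly.\<close>

lemma tendsto_dmodel:
  fixes Z :: "'b \<Rightarrow> real^'k^'n" and A :: "real^'n^'m" and Y :: "real^'k^'m"
  assumes \<gamma>: "0 \<le> \<gamma>" "\<gamma> \<le> 1"
    and Z: "(Z \<longlongrightarrow> Z') F" and X: "(X \<longlongrightarrow> X') F"
    and i: "\<And>k. invertible (gram \<gamma> (Z k))" "invertible (gram \<gamma> Z')"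
  shows "((\<lambda>k. dmodel \<gamma> \<alpha> A Y (Z k) (X k)) \<longlongrightarrow> dmodel \<gamma> \<alpha> A Y Z' X') F"
proof -
  note lims = Z X tendsto_weight[OF Z i]
  have terms: "((\<lambda>k. (1 - \<gamma>) / wnorm (weight \<gamma> (Z k)) (Z k $ n) *
        ((Z k *v (weight \<gamma> (Z k) *v Z k $ n)) \<bullet> (X k *v (weight \<gamma> (Z k) *v Z k $ n))))
      \<longlongrightarrow> (1 - \<gamma>) / wnorm (weight \<gamma> Z') (Z' $ n) *
        ((Z' *v (weight \<gamma> Z' *v Z' $ n)) \<bullet> (X' *v (weight \<gamma> Z' *v Z' $ n)))) F" (is "(?f \<longlongrightarrow> ?l) F") for n
  proof (cases "Z' $ n = 0")
    case True
    have "((\<lambda>k. wnorm2 (weight \<gamma> (Z k)) (X k) * wnorm (weight \<gamma> (Z k)) (Z k $ n))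
        \<longlongrightarrow> wnorm2 (weight \<gamma> Z') X' * wnorm (weight \<gamma> Z') (Z' $ n)) F"
      by (intro tendsto_intros lims)
    hence "((\<lambda>k. wnorm2 (weight \<gamma> (Z k)) (X k) * wnorm (weight \<gamma> (Z k)) (Z k $ n)) \<longlongrightarrow> 0) F"
      using True posdef_weight[OF \<gamma> i(2)] by simp
    hence "(?f \<longlongrightarrow> 0) F"
      by (rule Lim_null_comparison[rotated])
        (intro always_eventually allI, unfold real_norm_def, rule abs_dPsi_term_le[OF \<gamma> i(1)])
    thus ?thesis using True by simp
  next
    case False
    hence "wnorm (weight \<gamma> Z') (Z' $ n) \<noteq> 0" using wnorm_eq_0[OF posdef_weight[OF \<gamma> i(2)]] by simp
    thus ?thesis by (intro tendsto_intros lims)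
  qed
  show ?thesis
    unfolding dmodel_def dPsi_def
    by (intro tendsto_add tendsto_minus tendsto_sum terms tendsto_mult[OF tendsto_const] tendsto_inner
        tendsto_matrix_matrix_mult tendsto_diff tendsto_const lims)
qed

text \<open>Every entry is bounded by the operator norm; the crude factor is harmless because only
  uniformity matters.\<close>

lemma norm_le_onorm_bound:
  fixes Z :: "real^'k^'n"
  assumes "onorm (\<lambda>x. Z *v x) \<le> C"
  shows "norm Z \<le> real CARD('n) * (real CARD('k) * C)"
proof -
  have "norm Z \<le> (\<Sum>i\<in>UNIV. norm (Z $ i))"
    unfolding norm_vec_def[of Z] by (rule L2_set_le_sum) simp
  also have "\<dots> \<le> (\<Sum>i\<in>(UNIV::'n set). real CARD('k) * C)"
  proof (rule sum_mono)
    fix i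
    have "norm (Z $ i) \<le> (\<Sum>j\<in>UNIV. \<bar>Z $ i $ j\<bar>)" by (rule norm_le_l1_cart)
    also have "\<dots> \<le> (\<Sum>j\<in>(UNIV::'k set). C)"
      using assms by (intro sum_mono) (rule order.trans[OF matrix_component_le_onorm])
    finally show "norm (Z $ i) \<le> real CARD('k) * C" by simp
  qed
  finally show ?thesis by simp
qed

lemma objective_nonneg: "0 < \<alpha> \<Longrightarrow> 0 \<le> objective \<gamma> \<alpha> A Y Z"
  by (simp add: objective_def Psi_def norm21_def sum_nonneg)

theorem proposition6p8:
  fixes \<gamma> \<alpha> \<kappa> \<beta> \<sigma>max C0 :: real
    and A :: "real^'n^'m" and Y :: "real^'k^'m"
    and Z :: "nat \<Rightarrow> real^'k^'n" and \<sigma> :: "nat \<Rightarrow> real"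
  assumes "0 \<le> \<gamma>" and "\<gamma> \<le> 1" and "0 < \<alpha>"
    and "0 < \<kappa>" and "\<kappa> < 1" and "0 < \<beta>" and "\<beta> < 1" and "0 < \<sigma>max"
    and "0 < \<gamma> \<or> invertible (transpose (Z 0) ** Z 0)"
    and "\<forall>k. line_search \<gamma> \<alpha> A Y \<kappa> \<beta> \<sigma>max (case k of 0 \<Rightarrow> \<sigma>max | Suc j \<Rightarrow> \<sigma> j) (Z k) (\<sigma> k)"
    and "\<forall>k. Z (Suc k) = candidate \<gamma> \<alpha> A Y (\<sigma> k) (Z k)"
    and "\<forall>k\<ge>1. onorm (\<lambda>x. Z k *v x) \<le> C0"
  shows "(\<forall>k. objective \<gamma> \<alpha> A Y (Z (Suc k)) - objective \<gamma> \<alpha> A Y (Z k)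
              \<le> \<kappa> * predicted \<gamma> \<alpha> A Y (\<sigma> k) (Z k) \<and>
            \<kappa> * predicted \<gamma> \<alpha> A Y (\<sigma> k) (Z k) \<le> 0)
       \<and> (INF k. \<sigma> k) > 0
       \<and> (\<forall>Z' :: real^'k^'n.
            (\<exists>r :: nat \<Rightarrow> nat. strict_mono r \<and> (Z \<circ> r) \<longlonglongrightarrow> Z') \<longrightarrow>
            (0 < \<gamma> \<or> invertible (transpose Z' ** Z')) \<longrightarrow>
            0 \<in> clarke_subdiff (objective \<gamma> \<alpha> A Y) Z' \<and>
            (let W' = matrix_inv (gram \<gamma> Z'); D = transpose A ** (A ** Z' - Y) in
              \<forall>n.
                (Z' $ n \<noteq> 0 \<longrightarrow>
                   Z' $ n v* ((1 / wnorm W' (Z' $ n)) *\<^sub>R W'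
                     - (\<Sum>i\<in>{i. Z' $ i \<noteq> 0}. ((1 - \<gamma>) / wnorm W' (Z' $ i)) *\<^sub>R rank1 W' (Z' $ i)))
                   + (1 / \<alpha>) *\<^sub>R (D $ n) = 0) \<and>
                (Z' $ n = 0 \<longrightarrow> wnorm (matrix_inv W') (D $ n) \<le> \<alpha>)))"
proof -

  \<comment> \<open>Well-posedness and descent\<close>
  have \<gamma>: "0 \<le> \<gamma>" "\<gamma> \<le> 1" and \<alpha>: "0 < \<alpha>" and \<kappa>: "0 < \<kappa>" "\<kappa> < 1" and \<beta>: "0 < \<beta>" "\<beta> < 1"
    and smax: "0 < \<sigma>max" and bnd: "\<And>k. 1 \<le> k \<Longrightarrow> onorm (\<lambda>x. Z k *v x) \<le> C0"
    and step: "\<And>k. Z (Suc k) = candidate \<gamma> \<alpha> A Y (\<sigma> k) (Z k)"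
    using assms by auto
  let ?prev = "\<lambda>k. case k of 0 \<Rightarrow> \<sigma>max | Suc j \<Rightarrow> \<sigma> j"
  let ?J = "objective \<gamma> \<alpha> A Y"
  have ls: "line_search \<gamma> \<alpha> A Y \<kappa> \<beta> \<sigma>max (?prev k) (Z k) (\<sigma> k)" for k using assms(10) by blast
  have accepted: "acceptable \<gamma> \<alpha> A Y \<kappa> (Z k) (\<sigma> k)" for k
    using ls[of k] by (simp add: line_search_def Let_def)
  \<comment> \<open>At k = 0 this comes from the hypothesis, later from the acceptance test of the
    preceding step.\<close>
  have inv: "invertible (gram \<gamma> (Z k))" for k
  proof (cases k)
    case 0
    thus ?thesis using invertible_gram[OF \<gamma> assms(9)] by simp
  next
    case (Suc j)
    thus ?thesis using accepted[of j] by (simp add: acceptable_def step)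
  qed
  note W = posdef_weight[OF \<gamma> inv]
  have \<sigma>: "0 < \<sigma> k" for k
  proof (induction k)
    case 0
    show ?case using line_search_range(1)[OF ls[of 0] \<beta> smax] smax by simp
  next
    case (Suc k)
    show ?case using line_search_range(1)[OF ls[of "Suc k"] \<beta> smax] Suc by simp
  qed
  have prev: "0 < ?prev k" for k using \<sigma> smax by (cases k) auto
  have \<sigma>_le: "\<sigma> k \<le> \<sigma>max" for k by (rule line_search_range(2)[OF ls \<beta> smax prev])
  define pr where "pr k = predicted \<gamma> \<alpha> A Y (\<sigma> k) (Z k)" for k
  have descent: "?J (Z (Suc k)) - ?J (Z k) \<le> \<kappa> * pr k" for k
    using accepted[of k] by (simp add: acceptable_def step pr_def)
  have pr_nonpos: "pr k \<le> 0" for k unfolding pr_def by (rule predicted_nonpos[OF W \<sigma>])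
  have part1: "\<forall>k. ?J (Z (Suc k)) - ?J (Z k) \<le> \<kappa> * pr k \<and> \<kappa> * pr k \<le> 0"
    using descent pr_nonpos \<kappa> by (simp add: mult_nonneg_nonpos)

  \<comment> \<open>Lower bound on the step sizes\<close>
  define C where "C = max (norm (Z 0)) (real CARD('n) * (real CARD('k) * C0))"
  \<comment> \<open>The maximum with \<open>norm (Z 0)\<close> covers k = 0, as the assumed operator
    norm bound starts at k = 1.\<close>
  have C: "norm (Z k) \<le> C" for k
    using norm_le_onorm_bound[OF bnd[of k]] by (cases k) (auto simp: C_def)
  obtain s0 where s0: "0 < s0"
    "\<And>X :: real^'k^'n. \<And>s. norm X \<le> C \<Longrightarrow> invertible (gram \<gamma> X) \<Longrightarrow> 0 < s \<Longrightarrow> s \<le> s0 \<Longrightarrow>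
       acceptable \<gamma> \<alpha> A Y \<kappa> X s"
    by (rule small_steps_acceptable[OF \<gamma> \<alpha> \<kappa>(2)]) (rule that)
  define c where "c = min \<sigma>max (\<beta> * s0)"
  have c: "0 < c" using smax \<beta> s0 by (simp add: c_def)
  have lower: "min (min \<sigma>max (?prev k)) (\<beta> * s0) \<le> \<sigma> k" for k
    by (rule line_search_lower_bound[OF ls \<beta> smax prev]) (rule s0(2)[OF C inv])
  \<comment> \<open>The bound \<open>lower\<close> refers to the preceding step size, hence the
    induction; before k = 0 that size is \<open>\<sigma>max\<close>, which is at least c.\<close>
  have \<sigma>_ge: "c \<le> \<sigma> k" for k
  proof (induction k)
    case 0
    show ?case using lower[of 0] by (simp add: c_def)
  next
    case (Suc k)
    have "c \<le> min (min \<sigma>max (\<sigma> k)) (\<beta> * s0)" using Suc by (simp add: c_def)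
    also have "\<dots> \<le> \<sigma> (Suc k)" using lower[of "Suc k"] by simp
    finally show ?case .
  qed
  have part2: "(INF k. \<sigma> k) > 0"
    using c cINF_greatest[of UNIV c \<sigma>] \<sigma>_ge by (simp add: less_le_trans)

  \<comment> \<open>Vanishing predicted decreases and step lengths\<close>
  have Jpos: "0 \<le> ?J (Z k)" for k by (rule objective_nonneg[OF \<alpha>])
  have "decseq (\<lambda>k. ?J (Z k))"
    using part1 by (intro decseq_SucI) (smt (verit))
  then obtain Jl where Jl: "(\<lambda>k. ?J (Z k)) \<longlonglongrightarrow> Jl"
    using decseq_convergent[of "\<lambda>k. ?J (Z k)" 0] Jpos by blast
  \<comment> \<open>Monotone and bounded below, J converges, so its decreases tend to 0; divided by
    \<kappa> they dominate the predicted ones.\<close>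
  have "(\<lambda>k. (?J (Z k) - ?J (Z (Suc k))) / \<kappa>) \<longlonglongrightarrow> (Jl - Jl) / \<kappa>"
    using \<kappa> by (intro tendsto_intros Jl LIMSEQ_Suc) auto
  hence "(\<lambda>k. (?J (Z k) - ?J (Z (Suc k))) / \<kappa>) \<longlonglongrightarrow> 0" by simp
  hence pr_lim: "pr \<longlonglongrightarrow> 0"
  proof (rule Lim_null_comparison[rotated], intro always_eventually allI)
    fix k
    have "- (\<kappa> * pr k) \<le> ?J (Z k) - ?J (Z (Suc k))" using descent[of k] by linarith
    thus "norm (pr k) \<le> (?J (Z k) - ?J (Z (Suc k))) / \<kappa>"
      using \<kappa> pr_nonpos[of k] by (simp add: pos_le_divide_eq mult.commute)
  qed
  define d where "d k = wnorm2 (weight \<gamma> (Z k)) (Z (Suc k) - Z k)" for k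
  have d_nonneg: "0 \<le> d k" for k unfolding d_def by (rule wnorm2_nonneg[OF W])
  have "d k \<le> sqrt (\<sigma>max * (- pr k))" for k
  proof (rule real_le_rsqrt)
    have "(d k)\<^sup>2 \<le> \<sigma> k * (- pr k)"
      using predicted_descent[OF W \<sigma>, of k \<alpha> A Y k] by (simp add: d_def pr_def step)
    also have "\<dots> \<le> \<sigma>max * (- pr k)" using \<sigma>_le pr_nonpos by (intro mult_right_mono) auto
    finally show "(d k)\<^sup>2 \<le> \<sigma>max * (- pr k)" .
  qed
  moreover have "(\<lambda>k. sqrt (\<sigma>max * (- pr k))) \<longlonglongrightarrow> sqrt (\<sigma>max * (- 0))"
    by (intro tendsto_intros pr_lim)
  ultimately have d_lim: "d \<longlonglongrightarrow> 0"
    using d_nonneg by (intro Lim_null_comparison[of d "\<lambda>k. sqrt (\<sigma>max * (- pr k))"]) auto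

  \<comment> \<open>The variational inequality at an accumulation point\<close>
  have limit: "0 \<le> wnorm1 (weight \<gamma> Z') X - wnorm1 (weight \<gamma> Z') Z' + dmodel \<gamma> \<alpha> A Y Z' (X - Z')"
    if r: "strict_mono r" "(Z \<circ> r) \<longlonglongrightarrow> Z'" and i': "invertible (gram \<gamma> Z')"
    for r :: "nat \<Rightarrow> nat" and Z' X :: "real^'k^'n"
  proof -
    \<comment> \<open>The inequality is centred at the successor, while weight and gradient belong
      to \<open>Z (r k)\<close>; vanishing step lengths give both sequences the limit Z'.\<close>
    define P where "P k = Z (Suc (r k))" for k
    let ?W = "\<lambda>k. weight \<gamma> (Z (r k))"
    have Zr: "(\<lambda>k. Z (r k)) \<longlonglongrightarrow> Z'" using r(2) by (simp add: comp_def)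
    have Wr: "?W \<longlonglongrightarrow> weight \<gamma> Z'" by (rule tendsto_weight[OF Zr inv i'])
    have dr: "(\<lambda>k. d (r k)) \<longlonglongrightarrow> 0"
      using LIMSEQ_subseq_LIMSEQ[OF d_lim r(1)] by (simp add: comp_def)
    have "(\<lambda>k. P k - Z (r k)) \<longlonglongrightarrow> 0"
    proof (rule Lim_null_comparison, intro always_eventually allI)
      fix k
      have "norm (P k - Z (r k)) \<le> (1 + norm (Z (r k))) * d (r k)"
        unfolding d_def P_def by (rule norm_le_wnorm2[OF \<gamma> inv])
      also have "\<dots> \<le> (1 + C) * d (r k)" using C d_nonneg by (intro mult_right_mono) auto
      finally show "norm (P k - Z (r k)) \<le> (1 + C) * d (r k)" .
      show "(\<lambda>k. (1 + C) * d (r k)) \<longlonglongrightarrow> 0" using tendsto_mult_right_zero[OF dr] .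
    qed
    hence "(\<lambda>k. P k - Z (r k) + Z (r k)) \<longlonglongrightarrow> 0 + Z'" by (intro tendsto_intros Zr)
    hence P: "P \<longlonglongrightarrow> Z'" by simp
    \<comment> \<open>This bounds the proximal term divided by the step size; it tends to 0 only
      because the step sizes stay above c.\<close>
    let ?e = "\<lambda>k. d (r k) * wnorm2 (?W k) (X - P k) / c"
    have ineq: "0 \<le> wnorm1 (?W k) X - wnorm1 (?W k) (P k) + dmodel \<gamma> \<alpha> A Y (Z (r k)) (X - P k) + ?e k" for k
    proof -
      let ?s = "\<sigma> (r k)"
      define w where "w = wprod (?W k) (Z (r k) - P k) (X - P k)"
      have neg: "wprod (?W k) (Z (r k) - P k) (X - P k) = - wprod (?W k) (P k - Z (r k)) (X - P k)"
        by (simp add: wprod_diff_left)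
      have w: "\<bar>w\<bar> \<le> d (r k) * wnorm2 (?W k) (X - P k)"
        using wprod_Cauchy_Schwarz[OF W, of "r k" "P k - Z (r k)" "X - P k"]
        unfolding w_def neg abs_minus_cancel d_def P_def[symmetric] .
      have "w - ?s * dmodel \<gamma> \<alpha> A Y (Z (r k)) (X - P k) \<le> ?s * (wnorm1 (?W k) X - wnorm1 (?W k) (P k))"
        unfolding w_def P_def step by (rule candidate_variational[OF W \<sigma>])
      hence "w \<le> ?s * (wnorm1 (?W k) X - wnorm1 (?W k) (P k) + dmodel \<gamma> \<alpha> A Y (Z (r k)) (X - P k))"
        by (simp add: algebra_simps)
      hence 1: "w / ?s \<le> wnorm1 (?W k) X - wnorm1 (?W k) (P k) + dmodel \<gamma> \<alpha> A Y (Z (r k)) (X - P k)"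
        using \<sigma>[of "r k"] by (simp add: pos_divide_le_eq mult.commute)
      have "- (w / ?s) \<le> \<bar>w\<bar> / ?s" using \<sigma>[of "r k"] by (simp add: field_simps)
      also have "\<dots> \<le> ?e k"
        using w c \<sigma>_ge[of "r k"] by (intro frac_le) auto
      finally show ?thesis using 1 by linarith
    qed
    have "(\<lambda>k. wnorm1 (?W k) X - wnorm1 (?W k) (P k) + dmodel \<gamma> \<alpha> A Y (Z (r k)) (X - P k) + ?e k)
        \<longlonglongrightarrow> wnorm1 (weight \<gamma> Z') X - wnorm1 (weight \<gamma> Z') Z' + dmodel \<gamma> \<alpha> A Y Z' (X - Z')
          + 0 * wnorm2 (weight \<gamma> Z') (X - Z') / c"
      using c by (intro tendsto_intros tendsto_dmodel[OF \<gamma>] Zr Wr P dr inv i') auto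
    hence "0 \<le> wnorm1 (weight \<gamma> Z') X - wnorm1 (weight \<gamma> Z') Z' + dmodel \<gamma> \<alpha> A Y Z' (X - Z')
          + 0 * wnorm2 (weight \<gamma> Z') (X - Z') / c"
      by (rule LIMSEQ_le_const) (use ineq in blast)
    thus ?thesis by simp
  qed

  \<comment> \<open>Stationarity of accumulation points\<close>
  show ?thesis
  proof (intro conjI[OF part1[unfolded pr_def]] conjI[OF part2] allI impI)
    fix Z' :: "real^'k^'n"
    assume acc: "\<exists>r :: nat \<Rightarrow> nat. strict_mono r \<and> (Z \<circ> r) \<longlonglongrightarrow> Z'"
      and reg: "0 < \<gamma> \<or> invertible (transpose Z' ** Z')"
    have i': "invertible (gram \<gamma> Z')" by (rule invertible_gram[OF \<gamma> reg])
    obtain r :: "nat \<Rightarrow> nat" where r: "strict_mono r" "(Z \<circ> r) \<longlonglongrightarrow> Z'" using acc by blast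
    note vi = limit[OF r i']
    note rows = row_conditions[OF \<gamma> \<alpha> i' vi]
    show "0 \<in> clarke_subdiff ?J Z' \<and>
            (let W' = matrix_inv (gram \<gamma> Z'); D = transpose A ** (A ** Z' - Y) in
              \<forall>n.
                (Z' $ n \<noteq> 0 \<longrightarrow>
                   Z' $ n v* ((1 / wnorm W' (Z' $ n)) *\<^sub>R W'
                     - (\<Sum>i\<in>{i. Z' $ i \<noteq> 0}. ((1 - \<gamma>) / wnorm W' (Z' $ i)) *\<^sub>R rank1 W' (Z' $ i)))
                   + (1 / \<alpha>) *\<^sub>R (D $ n) = 0) \<and>
                (Z' $ n = 0 \<longrightarrow> wnorm (matrix_inv W') (D $ n) \<le> \<alpha>))"
      unfolding Let_def weight_def[symmetric]
    proof (intro conjI allI)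
      show "0 \<in> clarke_subdiff ?J Z'" by (rule clarke_stationary[OF \<gamma> \<alpha> i' vi])
    qed (rule impI, erule rows)+
  qed
qed

end
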